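(* Let $p$ be a prime and let $G$ be a (finitely generated) free $p$-group of nilpotency class $2$ and exponent $p$. Then for every $k\ge 1$, every word $w\in F_k$ and every $g\in G_w$, $N_{w,G}(g)\geq |G|^{k-1}$.
   Context: The free $p$-group of nilpotency class $2$ and exponent $p$ on $d$ generators is the quotient of the free group on $d$ generators by the normal subgroup generated by all $p$-th powers and all commutators $[[a,b],c]$; that it has class $2$ and exponent $p$ forces $p$ odd and $d\ge2$. It is a finite $p$-group. $F_k$ denotes the free pro-$p$ group of nilpotency class $2$ on $x_1,\dots,x_k$, whose elements are called words; each has a unique expression $x_1^{z_1}\cdots x_k^{z_k}\prod_{1\le i<j\le k}[x_i,x_j]^{z_{ij}}$ with $z_l,z_{ij}\in\mathbb{Z}_p$. For $g_1,\dots,g_k\in G$, $w(g_1,\dots,g_k)$ is the image of $w$ under the (continuous) homomorphism $F_k\to G$ with $x_i\mapsto g_i$. $G_w=\{w(g_1,\dots,g_k)\mid g_i\in G\}$ and $N_{w,G}(g)=|\{(g_1,\dots,g_k)\in G^{k}\mid w(g_1,\dots,g_k)=g\}|$. *)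

theory Defs
  imports "HOL-Algebra.Product_Groups" "HOL-Analysis.Function_Topology"
    "HOL-Computational_Algebra.Primes"
begin

section \<open>Free groups\<close>

text \<open>The letter \<open>(x, True)\<close> stands for the generator \<open>x\<close>, the letter \<open>(x, False)\<close> for its
  inverse. The elements of the free group are the reduced words.\<close>

definition inv_letter :: "'x \<times> bool \<Rightarrow> 'x \<times> bool" where
  "inv_letter l = (fst l, \<not> snd l)"

definition reduced :: "('x \<times> bool) list \<Rightarrow> bool" where
  "reduced u \<longleftrightarrow> successively (\<lambda>l m. m \<noteq> inv_letter l) u"

fun push_letter :: "'x \<times> bool \<Rightarrow> ('x \<times> bool) list \<Rightarrow> ('x \<times> bool) list" where
  "push_letter l [] = [l]"
| "push_letter l (m # u) = (if m = inv_letter l then u else l # m # u)"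

definition free_group :: "'x set \<Rightarrow> ('x \<times> bool) list monoid" where
  "free_group X =
     \<lparr>carrier = {u \<in> lists (X \<times> UNIV). reduced u}, monoid.mult = foldr push_letter, one = []\<rparr>"

definition free_gen :: "'x \<Rightarrow> ('x \<times> bool) list" where
  "free_gen x = [(x, True)]"


section \<open>Free groups of class 2 and prime exponent\<close>

definition commutator :: "('a, 'b) monoid_scheme \<Rightarrow> 'a \<Rightarrow> 'a \<Rightarrow> 'a" where
  "commutator G a b = inv\<^bsub>G\<^esub> a \<otimes>\<^bsub>G\<^esub> inv\<^bsub>G\<^esub> b \<otimes>\<^bsub>G\<^esub> a \<otimes>\<^bsub>G\<^esub> b"

definition triple_commutators :: "('a, 'b) monoid_scheme \<Rightarrow> 'a set" where
  "triple_commutators G = {commutator G (commutator G a b) c | a b c.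
     a \<in> carrier G \<and> b \<in> carrier G \<and> c \<in> carrier G}"

definition normal_closure :: "('a, 'b) monoid_scheme \<Rightarrow> 'a set \<Rightarrow> 'a set" where
  "normal_closure G S = \<Inter>{N. N \<lhd> G \<and> S \<subseteq> N}"

definition free_class2_exp_group :: "nat \<Rightarrow> nat \<Rightarrow> (nat \<times> bool) list set monoid" where
  "free_class2_exp_group p d =
     (let F = free_group {1..d}
      in F Mod normal_closure F ({a [^]\<^bsub>F\<^esub> p | a. a \<in> carrier F} \<union> triple_commutators F))"


section \<open>Free pro-\<open>p\<close> groups of class 2\<close>

definition p_group_class_le_2 :: "nat \<Rightarrow> ('a, 'b) monoid_scheme \<Rightarrow> bool" where
  "p_group_class_le_2 p G \<longleftrightarrow>
     group G \<and> (\<exists>n. order G = p ^ n) \<and> triple_commutators G \<subseteq> {\<one>\<^bsub>G\<^esub>}"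

text \<open>The free pro-\<open>p\<close> group of class 2 on a finite set \<open>X\<close> is the inverse limit of the quotients
  of the free group on \<open>X\<close> that are finite \<open>p\<close>-groups of class at most 2. A point of
  the limit is a family of cosets, one for each normal subgroup \<open>N\<close> in the index set;
  for \<open>N \<subseteq> M\<close> the projection maps the coset \<open>w N\<close> to \<open>w M\<close> iff \<open>w N \<subseteq> w M\<close>.\<close>

definition p2_kernels :: "nat \<Rightarrow> 'x set \<Rightarrow> ('x \<times> bool) list set set" where
  "p2_kernels p X = {N. N \<lhd> free_group X \<and> p_group_class_le_2 p (free_group X Mod N)}"

definition free_pro_p2 ::
  "nat \<Rightarrow> 'x set \<Rightarrow> (('x \<times> bool) list set \<Rightarrow> ('x \<times> bool) list set) monoid" where
  "free_pro_p2 p X =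
     (let P = product_group (p2_kernels p X) (\<lambda>N. free_group X Mod N)
      in P\<lparr>carrier := {w \<in> carrier P.
             \<forall>N\<in>p2_kernels p X. \<forall>M\<in>p2_kernels p X. N \<subseteq> M \<longrightarrow> w N \<subseteq> w M}\<rparr>)"

definition free_pro_p2_topology ::
  "nat \<Rightarrow> 'x set \<Rightarrow> (('x \<times> bool) list set \<Rightarrow> ('x \<times> bool) list set) topology" where
  "free_pro_p2_topology p X =
     subtopology
       (product_topology (\<lambda>N. discrete_topology (carrier (free_group X Mod N))) (p2_kernels p X))
       (carrier (free_pro_p2 p X))"

definition free_pro_p2_gen ::
  "nat \<Rightarrow> 'x set \<Rightarrow> 'x \<Rightarrow> (('x \<times> bool) list set \<Rightarrow> ('x \<times> bool) list set)" where
  "free_pro_p2_gen p X x = (\<lambda>N\<in>p2_kernels p X. N #>\<^bsub>free_group X\<^esub> free_gen x)"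


section \<open>Word maps\<close>

definition cont_extension ::
  "nat \<Rightarrow> 'x set \<Rightarrow> ('a, 'b) monoid_scheme \<Rightarrow> ('x \<Rightarrow> 'a) \<Rightarrow>
   ((('x \<times> bool) list set \<Rightarrow> ('x \<times> bool) list set) \<Rightarrow> 'a) \<Rightarrow> bool" where
  "cont_extension p X G g \<phi> \<longleftrightarrow>
     \<phi> \<in> hom (free_pro_p2 p X) G \<and>
     continuous_map (free_pro_p2_topology p X) (discrete_topology (carrier G)) \<phi> \<and>
     (\<forall>x\<in>X. \<phi> (free_pro_p2_gen p X x) = g x)"

definition word_value ::
  "nat \<Rightarrow> 'x set \<Rightarrow> ('a, 'b) monoid_scheme \<Rightarrow>
   (('x \<times> bool) list set \<Rightarrow> ('x \<times> bool) list set) \<Rightarrow> ('x \<Rightarrow> 'a) \<Rightarrow> 'a" where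
  "word_value p X G w g = (THE h. \<exists>\<phi>. cont_extension p X G g \<phi> \<and> h = \<phi> w)"

definition word_image ::
  "nat \<Rightarrow> nat \<Rightarrow> ('a, 'b) monoid_scheme \<Rightarrow>
   ((nat \<times> bool) list set \<Rightarrow> (nat \<times> bool) list set) \<Rightarrow> 'a set" where
  "word_image p k G w = word_value p {1..k} G w ` ({1..k} \<rightarrow>\<^sub>E carrier G)"

definition word_fibre_size ::
  "nat \<Rightarrow> nat \<Rightarrow> ('a, 'b) monoid_scheme \<Rightarrow>
   ((nat \<times> bool) list set \<Rightarrow> (nat \<times> bool) list set) \<Rightarrow> 'a \<Rightarrow> nat" where
  "word_fibre_size p k G w g =
     card {t \<in> {1..k} \<rightarrow>\<^sub>E carrier G. word_value p {1..k} G w t = g}"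

section \<open>Word values are well defined\<close>

text \<open>For a finite \<open>p\<close>-group \<open>G\<close> of class at most 2, every assignment of elements of \<open>G\<close> to
  the generators has a continuous extension (\<open>cont_extension_ex\<close>), and all continuous extensions
  take the same value at a given word (\<open>word_value_eq\<close>).\<close>

lemma inv_letter_inv [simp]: "inv_letter (inv_letter l) = l"
  by (simp add: inv_letter_def)

lemma reduced_push: "reduced u \<Longrightarrow> reduced (push_letter l u)"
  by (cases u) (auto simp: reduced_def successively_Cons)

lemma push_inverse: "reduced u \<Longrightarrow> push_letter (inv_letter l) (push_letter l u) = u"
  by (cases u rule: list.exhaust; cases "tl u") (auto simp: reduced_def)

lemma reduced_foldr: "reduced v \<Longrightarrow> reduced (foldr push_letter u v)"
  by (induction u) (auto simp: reduced_push)

lemma push_lists: "l \<in> A \<Longrightarrow> u \<in> lists A \<Longrightarrow> push_letter l u \<in> lists A"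
  by (cases u) auto

lemma foldr_push_lists: "u \<in> lists A \<Longrightarrow> v \<in> lists A \<Longrightarrow> foldr push_letter u v \<in> lists A"
  by (induction u) (use push_lists in \<open>fastforce simp del: in_lists_conv_set\<close>)+

lemma foldr_push: "reduced v \<Longrightarrow> foldr push_letter (push_letter l u) v = push_letter l (foldr push_letter u v)"
  using push_inverse[of _ "inv_letter l"]
  by (cases u) (auto simp: reduced_foldr)

lemma foldr_foldr: "reduced v \<Longrightarrow> reduced u' \<Longrightarrow> foldr push_letter (foldr push_letter u u') v = foldr push_letter u (foldr push_letter u' v)"
  by (induction u) (auto simp: foldr_push)

lemma foldr_self: "reduced u \<Longrightarrow> foldr push_letter u [] = u"
proof (induction u)
  case (Cons l u)
  then show ?case by (cases u) (auto simp: reduced_def)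
qed auto

lemma foldr_inverse: "reduced v \<Longrightarrow> foldr push_letter (rev (map inv_letter u)) (foldr push_letter u v) = v"
proof (induction u)
  case (Cons l u)
  then show ?case using push_inverse[of "foldr push_letter u v" l] by (simp add: reduced_foldr)
qed auto

lemma group_free_group: "group (free_group X)"
proof (rule groupI)
  fix u assume u: "u \<in> carrier (free_group X)"
  let ?v = "foldr push_letter (rev (map inv_letter u)) []"
  have r: "reduced ([] :: ('a \<times> bool) list)" by (simp add: reduced_def)
  have "?v \<in> carrier (free_group X)"
    using u r foldr_push_lists[of "rev (map inv_letter u)" "X \<times> UNIV" "[]"]
    by (fastforce simp: free_group_def reduced_foldr inv_letter_def)
  moreover have "?v \<otimes>\<^bsub>free_group X\<^esub> u = \<one>\<^bsub>free_group X\<^esub>"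
    using u r foldr_inverse[of "[]" u] by (simp add: free_group_def foldr_foldr foldr_self)
  ultimately show "\<exists>v\<in>carrier (free_group X). v \<otimes>\<^bsub>free_group X\<^esub> u = \<one>\<^bsub>free_group X\<^esub>" by blast
next
  fix u v assume "u \<in> carrier (free_group X)" "v \<in> carrier (free_group X)"
  then show "u \<otimes>\<^bsub>free_group X\<^esub> v \<in> carrier (free_group X)"
    using foldr_push_lists[of u "X \<times> UNIV" v] by (simp add: free_group_def reduced_foldr)
qed (auto simp: free_group_def reduced_foldr foldr_foldr reduced_def[of "[]"])

definition letter_val :: "('a,'b) monoid_scheme \<Rightarrow> ('x \<Rightarrow> 'a) \<Rightarrow> 'x \<times> bool \<Rightarrow> 'a" where
  "letter_val G g l = (if snd l then g (fst l) else inv\<^bsub>G\<^esub> g (fst l))"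

definition free_eval :: "('a,'b) monoid_scheme \<Rightarrow> ('x \<Rightarrow> 'a) \<Rightarrow> ('x \<times> bool) list \<Rightarrow> 'a" where
  "free_eval G g u = foldr (\<lambda>l a. letter_val G g l \<otimes>\<^bsub>G\<^esub> a) u \<one>\<^bsub>G\<^esub>"

context group begin

lemma letter_val_closed: "g \<in> X \<rightarrow> carrier G \<Longrightarrow> l \<in> X \<times> UNIV \<Longrightarrow> letter_val G g l \<in> carrier G"
  by (auto simp: letter_val_def)

lemma free_eval_closed: "g \<in> X \<rightarrow> carrier G \<Longrightarrow> u \<in> lists (X \<times> UNIV) \<Longrightarrow> free_eval G g u \<in> carrier G"
  by (induction u) (use letter_val_closed[of g X] in \<open>auto simp: free_eval_def\<close>)

lemma free_eval_push:
  assumes g: "g \<in> X \<rightarrow> carrier G" and l: "l \<in> X \<times> UNIV" and u: "u \<in> lists (X \<times> UNIV)"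
  shows "free_eval G g (push_letter l u) = letter_val G g l \<otimes> free_eval G g u"
proof (cases u)
  case (Cons m v)
  show ?thesis
  proof (cases "m = inv_letter l")
    case True
    have v: "free_eval G g v \<in> carrier G" using free_eval_closed[OF g, of v] u Cons by auto
    have gx: "g (fst l) \<in> carrier G" using g l by auto
    have "letter_val G g l \<otimes> (letter_val G g (inv_letter l) \<otimes> free_eval G g v) = free_eval G g v"
      using v gx by (auto simp: letter_val_def inv_letter_def m_assoc[symmetric])
    then show ?thesis using True Cons by (simp add: free_eval_def)
  qed (auto simp: Cons free_eval_def)
qed (auto simp: free_eval_def)

lemma free_eval_hom:
  assumes g: "g \<in> X \<rightarrow> carrier G"
  shows "free_eval G g \<in> hom (free_group X) G"
proof (rule homI)
  fix u assume "u \<in> carrier (free_group X)"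
  then show "free_eval G g u \<in> carrier G" using free_eval_closed[OF g, of u] by (auto simp: free_group_def)
next
  fix u v assume "u \<in> carrier (free_group X)" "v \<in> carrier (free_group X)"
  then have u: "u \<in> lists (X \<times> UNIV)" and v: "v \<in> lists (X \<times> UNIV)" by (auto simp: free_group_def)
  from u have "free_eval G g (foldr push_letter u v) = free_eval G g u \<otimes> free_eval G g v"
  proof (induction u)
    case Nil
    then show ?case using free_eval_closed[OF g v] by (simp add: free_eval_def)
  next
    case (Cons l u)
    have c: "letter_val G g l \<in> carrier G" using letter_val_closed[OF g Cons.hyps(1)] .
    have "free_eval G g (l # u) = letter_val G g l \<otimes> free_eval G g u" by (simp add: free_eval_def)
    then show ?case using free_eval_push[OF g Cons.hyps(1) foldr_push_lists[OF Cons.hyps(2) v]] Cons.IH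
       c free_eval_closed[OF g v] free_eval_closed[OF g Cons.hyps(2)] by (simp add: m_assoc)
  qed
  then show "free_eval G g (u \<otimes>\<^bsub>free_group X\<^esub> v) = free_eval G g u \<otimes> free_eval G g v" by (simp add: free_group_def)
qed

lemma free_eval_gen: "g \<in> X \<rightarrow> carrier G \<Longrightarrow> x \<in> X \<Longrightarrow> free_eval G g (free_gen x) = g x"
  using funcset_mem[of g X "carrier G" x] by (auto simp: free_eval_def free_gen_def letter_val_def)

end

lemma free_gen_closed: "x \<in> X \<Longrightarrow> free_gen x \<in> carrier (free_group X)"
  by (auto simp: free_group_def free_gen_def reduced_def)

lemma hom_unique_free:
  assumes "group G" and f: "f \<in> hom (free_group X) G" and h: "h \<in> hom (free_group X) G"
    and eq: "\<And>x. x \<in> X \<Longrightarrow> f (free_gen x) = h (free_gen x)" and u: "u \<in> carrier (free_group X)"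
  shows "f u = h u"
  using u
proof (induction u)
  interpret f: group_hom "free_group X" G f using assms group_free_group by (auto simp: group_hom_def group_hom_axioms_def)
  interpret h: group_hom "free_group X" G h using assms group_free_group by (auto simp: group_hom_def group_hom_axioms_def)
  case Nil
  then show ?case using f.hom_one h.hom_one by (simp add: free_group_def)
next
  interpret f: group_hom "free_group X" G f using assms group_free_group by (auto simp: group_hom_def group_hom_axioms_def)
  interpret h: group_hom "free_group X" G h using assms group_free_group by (auto simp: group_hom_def group_hom_axioms_def)
  case (Cons l u)
  have u: "u \<in> carrier (free_group X)" using Cons.prems by (cases u) (auto simp: free_group_def reduced_def)
  have l: "[l] \<in> carrier (free_group X)" "fst l \<in> X" using Cons.prems by (auto simp: free_group_def reduced_def)
  have split: "l # u = [l] \<otimes>\<^bsub>free_group X\<^esub> u"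
    using Cons.prems by (cases u) (auto simp: free_group_def reduced_def)
  have "f [l] = h [l]"
  proof (cases "snd l")
    case True
    then have "[l] = free_gen (fst l)" by (cases l) (auto simp: free_gen_def)
    then show ?thesis using eq l by auto
  next
    case False
    have "[l] = inv\<^bsub>free_group X\<^esub> (free_gen (fst l))"
      by (rule f.G.inv_equality[symmetric]) (use False l in \<open>auto simp: free_gen_closed, auto simp: free_group_def free_gen_def inv_letter_def\<close>)
    then show ?thesis using eq l by (simp add: free_gen_closed)
  qed
  then show ?case using Cons.IH[OF u] u l by (simp add: split)
qed

lemma hom_commutator:
  assumes "group_hom H K f" "a \<in> carrier H" "b \<in> carrier H"
  shows "f (commutator H a b) = commutator K (f a) (f b)" "commutator H a b \<in> carrier H"
proof -
  interpret group_hom H K f by fact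
  show "f (commutator H a b) = commutator K (f a) (f b)" "commutator H a b \<in> carrier H"
    using assms by (auto simp: commutator_def)
qed

lemma inj_p_group_class_le_2:
  assumes p: "prime p" and f: "group_hom H K f" "inj_on f (carrier H)" and K: "p_group_class_le_2 p K"
  shows "p_group_class_le_2 p H"
proof -
  interpret group_hom H K f by fact
  obtain n where n: "order K = p ^ n" using K by (auto simp: p_group_class_le_2_def)
  have "order K > 0" using n p by (simp add: prime_gt_0_nat)
  then have fin: "finite (carrier K)" unfolding order_def using card_gt_0_iff by blast
  have "card (f ` carrier H) dvd order K"
    using H.lagrange[OF img_is_subgroup] by (metis dvd_triv_right)
  moreover have "card (f ` carrier H) = order H" using f(2) by (simp add: card_image order_def)
  ultimately have "\<exists>m. order H = p ^ m" using n p by (metis divides_primepow_nat)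
  moreover have "triple_commutators H \<subseteq> {\<one>\<^bsub>H\<^esub>}"
  proof
    fix t assume "t \<in> triple_commutators H"
    then obtain a b c where t: "t = commutator H (commutator H a b) c" "a \<in> carrier H" "b \<in> carrier H" "c \<in> carrier H"
      by (auto simp: triple_commutators_def)
    note hc = hom_commutator[OF f(1)]
    have "f t = commutator K (commutator K (f a) (f b)) (f c)" using t hc by auto
    also have "\<dots> \<in> triple_commutators K" unfolding triple_commutators_def mem_Collect_eq
      by (rule exI[of _ "f a"] exI[of _ "f b"] exI[of _ "f c"])+ (use t in auto)
    finally have "f t = f \<one>\<^bsub>H\<^esub>" using K by (auto simp: p_group_class_le_2_def)
    moreover have "t \<in> carrier H" using t hc by auto
    ultimately show "t \<in> {\<one>\<^bsub>H\<^esub>}" using inj_onD[OF f(2), of t "\<one>\<^bsub>H\<^esub>"] by auto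
  qed
  ultimately show ?thesis by (auto simp: p_group_class_le_2_def)
qed

lemma kernel_in_p2:
  assumes p: "prime p" and K: "p_group_class_le_2 p K" and f: "f \<in> hom (free_group X) K"
  shows "kernel (free_group X) K f \<in> p2_kernels p X"
proof -
  interpret group_hom "free_group X" K f
    using assms group_free_group by (auto simp: group_hom_def group_hom_axioms_def p_group_class_le_2_def)
  let ?N = "kernel (free_group X) K f"
  interpret n: normal ?N "free_group X" by (rule normal_kernel)
  have "group_hom (free_group X Mod ?N) K (\<lambda>X. the_elem (f ` X))"
    using FactGroup_hom n.factorgroup_is_group by (auto simp: group_hom_def group_hom_axioms_def)
  from inj_p_group_class_le_2[OF p this FactGroup_inj_on K] show ?thesis
    using normal_kernel by (auto simp: p2_kernels_def)
qed

lemma DirProd_p2: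
  assumes "p_group_class_le_2 p H" "p_group_class_le_2 p K"
  shows "p_group_class_le_2 p (H \<times>\<times> K)"
proof -
  interpret H: group H using assms by (auto simp: p_group_class_le_2_def)
  interpret K: group K using assms by (auto simp: p_group_class_le_2_def)
  interpret HK: group "H \<times>\<times> K" by (intro DirProd_group H.is_group K.is_group)
  obtain m n where "order H = p ^ m" "order K = p ^ n" using assms by (auto simp: p_group_class_le_2_def)
  then have "order (H \<times>\<times> K) = p ^ (m + n)" by (simp add: order_def DirProd_def card_cartesian_product power_add)
  moreover have "triple_commutators (H \<times>\<times> K) \<subseteq> {\<one>\<^bsub>H \<times>\<times> K\<^esub>}"
  proof
    fix t assume "t \<in> triple_commutators (H \<times>\<times> K)"
    then obtain a b c where t: "t = commutator (H \<times>\<times> K) (commutator (H \<times>\<times> K) a b) c" 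
       "a \<in> carrier (H \<times>\<times> K)" "b \<in> carrier (H \<times>\<times> K)" "c \<in> carrier (H \<times>\<times> K)"
      by (auto simp: triple_commutators_def)
    have 1: "group_hom (H \<times>\<times> K) H fst" "group_hom (H \<times>\<times> K) K snd"
      by unfold_locales (auto simp: hom_def)
    note hc = hom_commutator[OF 1(1)] hom_commutator[OF 1(2)]
    have "fst t \<in> triple_commutators H" unfolding triple_commutators_def mem_Collect_eq
      by (rule exI[of _ "fst a"] exI[of _ "fst b"] exI[of _ "fst c"])+ (use t hc in \<open>auto\<close>)
    moreover have "snd t \<in> triple_commutators K" unfolding triple_commutators_def mem_Collect_eq
      by (rule exI[of _ "snd a"] exI[of _ "snd b"] exI[of _ "snd c"])+ (use t hc in \<open>auto\<close>)
    ultimately show "t \<in> {\<one>\<^bsub>H \<times>\<times> K\<^esub>}" using assms by (cases t) (auto simp: p_group_class_le_2_def)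
  qed
  ultimately show ?thesis by (auto simp: p_group_class_le_2_def HK.is_group)
qed

lemma p2_Int:
  assumes p: "prime p" and N: "N \<in> p2_kernels p X" and M: "M \<in> p2_kernels p X"
  shows "N \<inter> M \<in> p2_kernels p X"
proof -
  let ?F = "free_group X"
  interpret N: normal N ?F using N by (auto simp: p2_kernels_def)
  interpret M: normal M ?F using M by (auto simp: p2_kernels_def)
  let ?f = "\<lambda>a. (N #>\<^bsub>?F\<^esub> a, M #>\<^bsub>?F\<^esub> a)"
  have f: "?f \<in> hom ?F ((?F Mod N) \<times>\<times> (?F Mod M))"
    using N.r_coset_hom_Mod M.r_coset_hom_Mod by (auto simp: hom_def)
  have "kernel ?F ((?F Mod N) \<times>\<times> (?F Mod M)) ?f = N \<inter> M"
    using N.coset_join1[OF _ _ N.is_subgroup] N.coset_join1[OF _ _ M.is_subgroup]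
       N.coset_join2[OF _ N.is_subgroup] N.coset_join2[OF _ M.is_subgroup] N.subset M.subset
    by (auto simp: kernel_def DirProd_def)
  then show ?thesis using kernel_in_p2[OF p DirProd_p2 f] N M by (auto simp: p2_kernels_def)
qed

lemma p2_Inter:
  assumes p: "prime p" and J: "finite J" "J \<subseteq> p2_kernels p X" and K: "K \<in> p2_kernels p X"
  shows "K \<inter> \<Inter>J \<in> p2_kernels p X"
  using J by (induction J) (auto simp: K Int_left_commute intro: p2_Int[OF p])

lemma carrier_pro:
  "w \<in> carrier (free_pro_p2 p X) \<longleftrightarrow> w \<in> (\<Pi>\<^sub>E N\<in>p2_kernels p X. carrier (free_group X Mod N)) \<and>
   (\<forall>N\<in>p2_kernels p X. \<forall>M\<in>p2_kernels p X. N \<subseteq> M \<longrightarrow> w N \<subseteq> w M)"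
  by (simp add: free_pro_p2_def Let_def)

lemma mult_pro: "v \<otimes>\<^bsub>free_pro_p2 p X\<^esub> w = (\<lambda>N\<in>p2_kernels p X. v N <#>\<^bsub>free_group X\<^esub> w N)"
  by (simp add: free_pro_p2_def Let_def product_group_def)

definition emb :: "nat \<Rightarrow> 'x set \<Rightarrow> ('x \<times> bool) list \<Rightarrow> (('x \<times> bool) list set \<Rightarrow> ('x \<times> bool) list set)" where
  "emb p X a = (\<lambda>N\<in>p2_kernels p X. N #>\<^bsub>free_group X\<^esub> a)"

lemma emb_hom: "emb p X \<in> hom (free_group X) (free_pro_p2 p X)"
proof (rule homI)
  fix a assume "a \<in> carrier (free_group X)"
  then show "emb p X a \<in> carrier (free_pro_p2 p X)"
    by (auto simp: carrier_pro emb_def carrier_FactGroup r_coset_def)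
next
  fix a b assume ab: "a \<in> carrier (free_group X)" "b \<in> carrier (free_group X)"
  have "N #>\<^bsub>free_group X\<^esub> (a \<otimes>\<^bsub>free_group X\<^esub> b) = (N #>\<^bsub>free_group X\<^esub> a) <#>\<^bsub>free_group X\<^esub> (N #>\<^bsub>free_group X\<^esub> b)" 
    if "N \<in> p2_kernels p X" for N using normal.rcos_sum[of N "free_group X" a b] that ab by (auto simp: p2_kernels_def)
  then show "emb p X (a \<otimes>\<^bsub>free_group X\<^esub> b) = emb p X a \<otimes>\<^bsub>free_pro_p2 p X\<^esub> emb p X b"
    unfolding mult_pro emb_def by (auto simp: restrict_def fun_eq_iff)
qed

lemma cont_extension_value:
  assumes p: "prime p" and G: "p_group_class_le_2 p G" and g: "g \<in> X \<rightarrow> carrier G"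
    and ext: "cont_extension p X G g \<phi>" and w: "w \<in> carrier (free_pro_p2 p X)"
    and a: "a \<in> w (kernel (free_group X) G (free_eval G g))"
  shows "\<phi> w = free_eval G g a"
proof -
  let ?F = "free_group X" and ?e = "free_eval G g"
  let ?K = "kernel ?F G ?e" and ?I = "p2_kernels p X"
  interpret G: group G using G by (auto simp: p_group_class_le_2_def)
  interpret e: group_hom ?F G ?e using G.free_eval_hom[OF g] group_free_group
     by (auto simp: group_hom_def group_hom_axioms_def G.is_group)
  have K: "?K \<in> ?I" by (rule kernel_in_p2[OF p G e.homh])
  let ?P = "product_topology (\<lambda>N. discrete_topology (carrier (?F Mod N))) ?I"
  have top: "topspace (free_pro_p2_topology p X) = carrier (free_pro_p2 p X)"
  proof -
    have "carrier (free_pro_p2 p X) \<subseteq> topspace ?P"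
      unfolding topspace_product_topology topspace_discrete_topology comp_def by (rule subsetI) (rule conjunct1[OF iffD1[OF carrier_pro]])
    then show ?thesis unfolding free_pro_p2_topology_def topspace_subtopology by (rule Int_absorb1)
  qed
  have \<phi>: "\<phi> \<in> hom (free_pro_p2 p X) G" using ext by (auto simp: cont_extension_def)
  have "openin (free_pro_p2_topology p X) {v \<in> topspace (free_pro_p2_topology p X). \<phi> v \<in> {\<phi> w}}"
    by (rule openin_continuous_map_preimage[of _ "discrete_topology (carrier G)"])
      (use ext w \<phi> in \<open>auto simp: cont_extension_def hom_def\<close>)
  then obtain T where T: "openin ?P T" "{v \<in> carrier (free_pro_p2 p X). \<phi> v = \<phi> w} = T \<inter> carrier (free_pro_p2 p X)"
    unfolding top by (auto simp: free_pro_p2_topology_def openin_subtopology)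
  have "w \<in> T" using T w by auto
  then obtain U where U: "finite {N \<in> ?I. U N \<noteq> carrier (?F Mod N)}" "w \<in> Pi\<^sub>E ?I U" "Pi\<^sub>E ?I U \<subseteq> T"
    using T(1) unfolding openin_product_topology_alt by auto
  define J where "J = {N \<in> ?I. U N \<noteq> carrier (?F Mod N)}"
  have N0: "?K \<inter> \<Inter>J \<in> ?I" by (rule p2_Inter[OF p _ _ K]) (use U in \<open>auto simp: J_def\<close>)
  have "w (?K \<inter> \<Inter>J) \<in> carrier (?F Mod (?K \<inter> \<Inter>J))" using w N0 by (auto simp: carrier_pro PiE_iff)
  then obtain b where b: "b \<in> carrier ?F" "w (?K \<inter> \<Inter>J) = (?K \<inter> \<Inter>J) #>\<^bsub>?F\<^esub> b" by (auto simp: carrier_FactGroup)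
  have sub: "subgroup N ?F" if "N \<in> ?I" for N using that by (auto simp: p2_kernels_def normal_def)
  have bw: "w M = M #>\<^bsub>?F\<^esub> b" if M: "M \<in> ?I" "?K \<inter> \<Inter>J \<subseteq> M" for M
  proof -
    have "b \<in> w (?K \<inter> \<Inter>J)" using b e.rcos_self[OF b(1) sub[OF N0]] by simp
    moreover have "w (?K \<inter> \<Inter>J) \<subseteq> w M" using w N0 M unfolding carrier_pro by blast
    ultimately have "b \<in> w M" by blast
    moreover have "w M \<in> carrier (?F Mod M)" using w M by (auto simp: carrier_pro PiE_iff)
    ultimately show ?thesis using e.repr_independence[OF _ _ sub[OF M(1)]] by (auto simp: carrier_FactGroup)
  qed
  have "emb p X b \<in> Pi\<^sub>E ?I U"
  proof (rule PiE_I)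
    fix N assume N: "N \<in> ?I"
    show "emb p X b N \<in> U N"
    proof (cases "N \<in> J")
      case True
      then have "emb p X b N = w N" using bw[OF N] N by (auto simp: emb_def)
      then show ?thesis using U(2) N by auto
    next
      case False
      then show ?thesis using N b by (auto simp: J_def emb_def carrier_FactGroup)
    qed
  qed (auto simp: emb_def)
  moreover have "emb p X b \<in> carrier (free_pro_p2 p X)" using hom_in_carrier[OF emb_hom b(1)] .
  ultimately have "emb p X b \<in> {v \<in> carrier (free_pro_p2 p X). \<phi> v = \<phi> w}" unfolding T(2) using U(3) by blast
  then have "\<phi> (emb p X b) = \<phi> w" by simp
  moreover have "(\<phi> \<circ> emb p X) b = ?e b"
  proof (rule hom_unique_free[OF G.is_group _ e.homh _ b(1)])
    show "\<phi> \<circ> emb p X \<in> hom ?F G" using hom_compose[OF emb_hom \<phi>] .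
    show "(\<phi> \<circ> emb p X) (free_gen x) = ?e (free_gen x)" if "x \<in> X" for x
      using ext that G.free_eval_gen[OF g that] by (auto simp: cont_extension_def emb_def free_pro_p2_gen_def)
  qed
  moreover have "?e a = ?e b"
    using a bw[OF K] b e.hom_mult by (auto simp: kernel_def r_coset_def)
  ultimately show ?thesis by simp
qed

lemma cont_extension_ex:
  assumes p: "prime p" and G: "p_group_class_le_2 p G" and g: "g \<in> X \<rightarrow> carrier G"
  shows "\<exists>\<phi>. cont_extension p X G g \<phi>"
proof -
  let ?F = "free_group X" and ?e = "free_eval G g"
  let ?K = "kernel ?F G ?e" and ?I = "p2_kernels p X"
  interpret G: group G using G by (auto simp: p_group_class_le_2_def)
  interpret e: group_hom ?F G ?e using G.free_eval_hom[OF g] group_free_group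
     by (auto simp: group_hom_def group_hom_axioms_def G.is_group)
  have K: "?K \<in> ?I" by (rule kernel_in_p2[OF p G e.homh])
  let ?h = "\<lambda>Y. the_elem (?e ` Y)"
  let ?\<phi> = "\<lambda>w. ?h (w ?K)"
  have h: "?h \<in> hom (?F Mod ?K) G" by (rule e.FactGroup_hom)
  have c: "w ?K \<in> carrier (?F Mod ?K)" if "w \<in> carrier (free_pro_p2 p X)" for w
    using that K by (auto simp: carrier_pro PiE_iff)
  have "?\<phi> \<in> hom (free_pro_p2 p X) G"
  proof (rule homI)
    fix w assume "w \<in> carrier (free_pro_p2 p X)"
    then show "?\<phi> w \<in> carrier G" using h c hom_in_carrier by metis
  next
    fix v w assume "v \<in> carrier (free_pro_p2 p X)" "w \<in> carrier (free_pro_p2 p X)"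
    then show "?\<phi> (v \<otimes>\<^bsub>free_pro_p2 p X\<^esub> w) = ?\<phi> v \<otimes>\<^bsub>G\<^esub> ?\<phi> w"
      using hom_mult[OF h c c] K by (simp add: mult_pro)
  qed
  moreover have "continuous_map (free_pro_p2_topology p X) (discrete_topology (carrier G)) ?\<phi>"
  proof -
    have "continuous_map (free_pro_p2_topology p X) (discrete_topology (carrier (?F Mod ?K))) (\<lambda>w. w ?K)"
      unfolding free_pro_p2_topology_def
      by (intro continuous_map_from_subtopology continuous_map_product_projection[OF K])
    moreover have "continuous_map (discrete_topology (carrier (?F Mod ?K))) (discrete_topology (carrier G)) ?h"
      using h by (auto simp: hom_def)
    ultimately show ?thesis using continuous_map_compose[unfolded o_def] by blast
  qed
  moreover have "?\<phi> (free_pro_p2_gen p X x) = g x" if x: "x \<in> X" for x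
  proof -
    have gx: "?e (free_gen x) = g x" "g x \<in> carrier G" using G.free_eval_gen[OF g x] g x by auto
    have "?e y = g x" if "y \<in> ?K #>\<^bsub>?F\<^esub> free_gen x" for y
    proof -
      from that obtain z where "z \<in> carrier ?F" "?e z = \<one>\<^bsub>G\<^esub>" "y = z \<otimes>\<^bsub>?F\<^esub> free_gen x" by (auto simp: r_coset_def kernel_def)
      then show ?thesis using gx free_gen_closed[OF x] by simp
    qed
    moreover have "free_gen x \<in> ?K #>\<^bsub>?F\<^esub> free_gen x"
      using e.rcos_self[OF free_gen_closed[OF x] e.subgroup_kernel] .
    ultimately have "?e ` (?K #>\<^bsub>?F\<^esub> free_gen x) = {g x}"
      unfolding set_eq_iff image_iff singleton_iff using gx(1) by metis
    then show ?thesis using K by (simp add: free_pro_p2_gen_def)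
  qed
  ultimately have "cont_extension p X G g ?\<phi>" unfolding cont_extension_def by blast
  then show ?thesis by (rule exI[where P = "cont_extension p X G g"])
qed

lemma word_value_eq:
  assumes p: "prime p" and G: "p_group_class_le_2 p G" and g: "g \<in> X \<rightarrow> carrier G"
    and w: "w \<in> carrier (free_pro_p2 p X)" and ext: "cont_extension p X G g \<phi>"
  shows "word_value p X G w g = \<phi> w"
proof -
  let ?K = "kernel (free_group X) G (free_eval G g)"
  interpret G: group G using G by (auto simp: p_group_class_le_2_def)
  have K: "?K \<in> p2_kernels p X" by (rule kernel_in_p2[OF p G G.free_eval_hom[OF g]])
  then have "w ?K \<in> carrier (free_group X Mod ?K)" using w by (auto simp: carrier_pro PiE_iff)
  then obtain b where b: "b \<in> carrier (free_group X)" "w ?K = ?K #>\<^bsub>free_group X\<^esub> b"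
    unfolding carrier_FactGroup by blast
  have "subgroup ?K (free_group X)" using K unfolding p2_kernels_def normal_def by blast
  then obtain a where "a \<in> w ?K" using group.rcos_self[OF group_free_group b(1)] b(2) by blast
  note val = cont_extension_value[OF p G g _ w this]
  show ?thesis unfolding word_value_def
  proof (rule the_equality)
    show "\<exists>\<psi>. cont_extension p X G g \<psi> \<and> \<phi> w = \<psi> w" using ext by blast
    show "h = \<phi> w" if "\<exists>\<psi>. cont_extension p X G g \<psi> \<and> h = \<psi> w" for h
      using that val ext by metis
  qed
qed

end

theory Submission
  imports Defs "HOL-Number_Theory.Cong"
begin

text \<open>The group is isomorphic to the group of pairs (\<open>v\<close>, \<open>c\<close>) with \<open>v\<close> in \<open>V = \<bbbF>\<^sub>p\<^sup>d\<close> and one entry \<open>c\<^sub>a\<^sub>b\<close> in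
  \<open>\<bbbF>\<^sub>p\<close> for every \<open>a < b\<close>, where multiplication adds \<open>v\<^sub>a v'\<^sub>b\<close> to \<open>c\<^sub>a\<^sub>b + c'\<^sub>a\<^sub>b\<close>. As the tuples of group elements are
  finitely many, a word of the free pro-\<open>p\<close> group acts on them like a word of the free group.

  If the exponent sum of some variable \<open>x\<close> is not divisible by \<open>p\<close>, the value of the word is a bijective
  function of \<open>x\<close> when the other variables are fixed, and all fibres have \<open>|G|\<^sup>k\<^sup>-\<^sup>1\<close> elements.

  Otherwise the value has \<open>v = 0\<close> and \<open>c\<^sub>a\<^sub>b = \<omega>(r\<^sub>a, r\<^sub>b)\<close>, where \<open>\<omega>\<close> is an alternating form on \<open>\<bbbF>\<^sub>p\<^sup>k\<close> and
  \<open>r\<^sub>a\<close> is the vector of the \<open>a\<close>-th coordinates of the \<open>k\<close> arguments. So one has to show that the \<open>d\<close>-tuples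
  of vectors with a given Gram matrix, if there are any, number at least \<open>p\<close> to the power \<open>dk - d(d+1)/2\<close>.
  This is an induction on \<open>d\<close>. If some tuple is dependent modulo the radical of \<open>\<omega>\<close>, one of its members can be
  dropped, and every shorter tuple extends, in at least \<open>p\<close> to the power \<open>k - d + 1\<close> ways, because the conditions
  on the new vector are linear and solvable. If every tuple is independent, an extendable tuple
  has exactly this number of extensions, and those dependent on it are either none or
  a proper affine subspace whose size depends only on the Gram matrix; so at least
  half of the extensions remain.\<close>

section \<open>Tuples with a given Gram matrix\<close>

text \<open>The entries of \<open>C\<close> are integers read modulo \<open>p\<close>, so that
  coefficients extracted from a word serve directly as the matrix of a form. For
  \<open>p = 2\<close> antisymmetry does not imply the diagonal condition.\<close>

locale alternating_form =
  fixes p :: nat and K :: "'k set" and C :: "'k \<Rightarrow> 'k \<Rightarrow> int"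
  assumes prime_p: "prime p" and finite_K: "finite K"
    and antisym: "\<And>i j. i \<in> K \<Longrightarrow> j \<in> K \<Longrightarrow> [C i j + C j i = 0] (mod int p)"
    and diag: "\<And>i. i \<in> K \<Longrightarrow> [C i i = 0] (mod int p)"
begin

abbreviation pcong :: "int \<Rightarrow> int \<Rightarrow> bool" (infix "\<doteq>" 50) where
  "a \<doteq> b \<equiv> [a = b] (mod int p)"

definition form :: "('k \<Rightarrow> int) \<Rightarrow> ('k \<Rightarrow> int) \<Rightarrow> int" where
  "form x y = (\<Sum>i\<in>K. \<Sum>j\<in>K. C i j * x i * y j)"

definition vectors :: "('k \<Rightarrow> int) set" where
  "vectors = K \<rightarrow>\<^sub>E {0..<int p}"

definition reduce :: "('k \<Rightarrow> int) \<Rightarrow> 'k \<Rightarrow> int" where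
  "reduce x = (\<lambda>i\<in>K. x i mod int p)"

definition comb :: "'i set \<Rightarrow> ('i \<Rightarrow> int) \<Rightarrow> ('i \<Rightarrow> 'k \<Rightarrow> int) \<Rightarrow> 'k \<Rightarrow> int" where
  "comb I l a = (\<lambda>i. \<Sum>\<alpha>\<in>I. l \<alpha> * a \<alpha> i)"

definition indep :: "'i set \<Rightarrow> ('i \<Rightarrow> 'k \<Rightarrow> int) \<Rightarrow> bool" where
  \<comment> \<open>linear independence modulo the radical of the form\<close>
  "indep I a \<longleftrightarrow> (\<forall>l. (\<forall>x. form (comb I l a) x \<doteq> 0) \<longrightarrow> (\<forall>\<alpha>\<in>I. l \<alpha> \<doteq> 0))"

definition solutions :: "'i set \<Rightarrow> ('i \<Rightarrow> 'k \<Rightarrow> int) \<Rightarrow> ('i \<Rightarrow> int) \<Rightarrow> ('k \<Rightarrow> int) set" where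
  "solutions I a h = {y \<in> vectors. \<forall>\<alpha>\<in>I. form (a \<alpha>) y \<doteq> h \<alpha>}"

text \<open>Membership of \<open>y\<close> in the span of the tuple plus the radical of the
  form.\<close>

definition dependent_on :: "'i set \<Rightarrow> ('i \<Rightarrow> 'k \<Rightarrow> int) \<Rightarrow> ('k \<Rightarrow> int) \<Rightarrow> bool" where
  "dependent_on I a y \<longleftrightarrow> (\<exists>l. \<forall>x. form y x \<doteq> form (comb I l a) x)"

definition gram_tuples :: "'i set \<Rightarrow> ('i \<Rightarrow> 'i \<Rightarrow> int) \<Rightarrow> ('i \<Rightarrow> 'k \<Rightarrow> int) set" where
  "gram_tuples I g = {a \<in> I \<rightarrow>\<^sub>E vectors. \<forall>\<alpha>\<in>I. \<forall>\<beta>\<in>I. form (a \<alpha>) (a \<beta>) \<doteq> g \<alpha> \<beta>}"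

section \<open>Bilinearity and reduction modulo p\<close>

lemma p_pos: "0 < int p" and p_ge_2: "2 \<le> p"
  using prime_p prime_gt_0_nat prime_ge_2_nat by auto

lemma finite_vectors: "finite vectors" and card_vectors: "card vectors = p ^ card K"
  unfolding vectors_def by (auto simp: finite_K card_PiE finite_PiE)

lemma reduce_in_vectors [simp]: "reduce x \<in> vectors"
  using p_pos by (auto simp: reduce_def vectors_def)

lemma form_cong:
  assumes "\<And>i. i \<in> K \<Longrightarrow> x i \<doteq> x' i" "\<And>i. i \<in> K \<Longrightarrow> y i \<doteq> y' i"
  shows "form x y \<doteq> form x' y'"
  unfolding form_def by (intro cong_sum cong_mult assms) auto

lemma reduce_cong: "i \<in> K \<Longrightarrow> reduce x i \<doteq> x i"
  by (simp add: reduce_def cong_def)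

lemma form_reduce_left: "form (reduce x) y \<doteq> form x y"
  and form_reduce_right: "form y (reduce x) \<doteq> form y x"
  by (rule form_cong; simp add: reduce_cong)+

lemma vectors_eqI:
  assumes "x \<in> vectors" "y \<in> vectors" "\<And>i. i \<in> K \<Longrightarrow> x i \<doteq> y i"
  shows "x = y"
proof (rule PiE_ext[OF assms(1,2)[unfolded vectors_def]])
  fix i assume i: "i \<in> K"
  then have "x i \<in> {0..<int p}" "y i \<in> {0..<int p}" using assms(1,2) by (auto simp: vectors_def)
  then show "x i = y i" using assms(3)[OF i] by (simp add: cong_def)
qed

lemma form_add_left: "form (\<lambda>i. x i + y i) z = form x z + form y z"
  and form_add_right: "form z (\<lambda>i. x i + y i) = form z x + form z y"
  by (simp_all add: form_def ring_distribs sum.distrib)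

lemma form_diff_left: "form (\<lambda>i. x i - y i) z = form x z - form y z"
  and form_diff_right: "form z (\<lambda>i. x i - y i) = form z x - form z y"
  by (simp_all add: form_def left_diff_distrib right_diff_distrib sum_subtractf)

lemma form_scale_left: "form (\<lambda>i. c * x i) z = c * form x z"
  and form_scale_right: "form z (\<lambda>i. c * x i) = c * form z x"
  by (simp_all add: form_def sum_distrib_left mult_ac)

lemma form_sum_left: "form (\<lambda>i. \<Sum>\<alpha>\<in>I. x \<alpha> i) z = (\<Sum>\<alpha>\<in>I. form (x \<alpha>) z)"
proof (cases "finite I")
  case True then show ?thesis
    by (induction I) (simp_all add: form_add_left, simp add: form_def)
qed (simp add: form_def)

lemma form_sum_right: "form z (\<lambda>i. \<Sum>\<alpha>\<in>I. x \<alpha> i) = (\<Sum>\<alpha>\<in>I. form z (x \<alpha>))"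
proof (cases "finite I")
  case True then show ?thesis
    by (induction I) (simp_all add: form_add_right, simp add: form_def)
qed (simp add: form_def)

lemma form_comb: "form (comb I l a) z = (\<Sum>\<alpha>\<in>I. l \<alpha> * form (a \<alpha>) z)"
  by (simp add: comb_def form_sum_left form_scale_left)

lemma form_antisym: "form x y + form y x \<doteq> 0"
proof -
  have "form y x = (\<Sum>i\<in>K. \<Sum>j\<in>K. C j i * x i * y j)"
    unfolding form_def by (subst sum.swap) (simp add: algebra_simps)
  then have "form x y + form y x = (\<Sum>i\<in>K. \<Sum>j\<in>K. (C i j + C j i) * x i * y j)"
    by (simp add: form_def sum.distrib algebra_simps)
  also have "\<dots> \<doteq> (\<Sum>i\<in>K. \<Sum>j\<in>K. 0 * x i * y j)"
    by (intro cong_sum cong_mult antisym) auto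
  finally show ?thesis by simp
qed

lemma form_neg: "form x y \<doteq> - form y x"
  using form_antisym[of x y] by (simp add: cong_iff_dvd_diff)

text \<open>Antisymmetry alone gives only \<open>2 * form x x \<doteq> 0\<close>. A new index
  \<open>m\<close> in \<open>J\<close> adds the diagonal term at \<open>m\<close> and the pairs
  \<open>C m j + C j m\<close>, all of which vanish modulo \<open>p\<close>.\<close>

lemma form_self: "form x x \<doteq> 0"
proof -
  have split: "(\<Sum>i\<in>J. \<Sum>j\<in>J. C i j * x i * x j) \<doteq> 0" if "J \<subseteq> K" for J
    using finite_subset[OF that finite_K] that
  proof (induction J)
    case (insert m J)
    have e: "(\<Sum>i\<in>insert m J. \<Sum>j\<in>insert m J. C i j * x i * x j)
      = C m m * x m * x m + (\<Sum>j\<in>J. (C m j + C j m) * x m * x j) + (\<Sum>i\<in>J. \<Sum>j\<in>J. C i j * x i * x j)"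
      using insert by (simp add: sum.distrib algebra_simps)
    also have "\<dots> \<doteq> 0 * x m * x m + (\<Sum>j\<in>J. 0 * x m * x j) + 0"
      by (intro cong_add cong_mult cong_sum antisym diag) (use insert in auto)
    finally show ?case by simp
  qed simp
  show ?thesis unfolding form_def using split[of K] by simp
qed

section \<open>Linear systems modulo p\<close>

lemma inverse_mod:
  assumes "\<not> c \<doteq> 0" shows "\<exists>c'. c' * c \<doteq> 1"
proof -
  have "\<not> int p dvd c" using assms by (simp add: cong_0_iff)
  then have "coprime (int p) c" using prime_p by (simp add: prime_imp_coprime)
  then show ?thesis using cong_solve_coprime_int[of c "int p"] by (auto simp: mult.commute coprime_commute)
qed

text \<open>Nonempty solution sets for different right-hand sides are translates of each other:
  \<open>y - z' + z\<close> carries a solution for \<open>h'\<close> to one for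
  \<open>h\<close>.\<close>

lemma card_solutions_le:
  assumes "z \<in> solutions I a h"
  shows "card (solutions I a h') \<le> card (solutions I a h)"
proof (cases "solutions I a h' = {}")
  case False
  then obtain z' where z': "z' \<in> solutions I a h'" by auto
  have fin: "finite (solutions I a h)" using finite_vectors by (simp add: solutions_def)
  let ?f = "\<lambda>y. reduce (\<lambda>i. y i - z' i + z i)"
  show ?thesis
  proof (rule card_inj_on_le[of ?f])
    show "inj_on ?f (solutions I a h')"
    proof (rule inj_onI)
      fix x y assume *: "x \<in> solutions I a h'" "y \<in> solutions I a h'" "?f x = ?f y"
      show "x = y"
      proof (rule vectors_eqI)
        fix i assume i: "i \<in> K"
        have "x i - z' i + z i \<doteq> y i - z' i + z i"
          using fun_cong[OF *(3), of i] i by (simp add: reduce_def cong_def)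
        then show "x i \<doteq> y i" by (simp add: cong_iff_dvd_diff)
      qed (use * in \<open>auto simp: solutions_def\<close>)
    qed
    show "?f ` solutions I a h' \<subseteq> solutions I a h"
    proof clarify
      fix y assume y: "y \<in> solutions I a h'"
      have "form (a \<alpha>) (?f y) \<doteq> h \<alpha>" if "\<alpha> \<in> I" for \<alpha>
      proof -
        have "form (a \<alpha>) y - form (a \<alpha>) z' + form (a \<alpha>) z \<doteq> h' \<alpha> - h' \<alpha> + h \<alpha>"
          by (intro cong_add cong_diff) (use y z' assms that in \<open>auto simp: solutions_def\<close>)
        then show ?thesis using form_reduce_right[of "a \<alpha>" "\<lambda>i. y i - z' i + z i"]
          unfolding form_add_right form_diff_right using cong_trans by fastforce
      qed
      then show "?f y \<in> solutions I a h" by (simp add: solutions_def)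
    qed
  qed (rule fin)
qed simp

text \<open>Every vector solves the system for exactly one reduced right-hand side, so the solution
  sets partition \<open>vectors\<close>.\<close>

lemma sum_card_solutions:
  assumes I: "finite I"
  shows "(\<Sum>h\<in>I \<rightarrow>\<^sub>E {0..<int p}. card (solutions I a h)) = p ^ card K"
proof -
  let ?H = "I \<rightarrow>\<^sub>E {0..<int p}"
  have fin: "finite ?H" using I by (simp add: finite_PiE)
  have disj: "solutions I a h \<inter> solutions I a h' = {}" if "h \<in> ?H" "h' \<in> ?H" "h \<noteq> h'" for h h'
  proof (rule ccontr)
    assume "\<not> ?thesis"
    then obtain y where y: "y \<in> solutions I a h" "y \<in> solutions I a h'" by auto
    have "h = h'"
    proof (rule PiE_ext[OF that(1,2)])
      fix \<alpha> assume \<alpha>: "\<alpha> \<in> I"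
      then have "h \<alpha> \<doteq> h' \<alpha>" using y by (auto simp: solutions_def cong_def)
      moreover have "h \<alpha> \<in> {0..<int p}" "h' \<alpha> \<in> {0..<int p}" using that \<alpha> by (auto simp: PiE_iff)
      ultimately show "h \<alpha> = h' \<alpha>" by (simp add: cong_def)
    qed
    then show False using that by simp
  qed
  have "vectors = (\<Union>h\<in>?H. solutions I a h)"
  proof (intro equalityI subsetI)
    fix y assume "y \<in> vectors"
    then have "y \<in> solutions I a (\<lambda>\<alpha>\<in>I. form (a \<alpha>) y mod int p)"
      by (auto simp: solutions_def cong_def)
    moreover have "(\<lambda>\<alpha>\<in>I. form (a \<alpha>) y mod int p) \<in> ?H" using p_pos by auto
    ultimately show "y \<in> (\<Union>h\<in>?H. solutions I a h)" by blast
  qed (auto simp: solutions_def)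
  then have "card vectors = card (\<Union>h\<in>?H. solutions I a h)" by simp
  also have "\<dots> = (\<Sum>h\<in>?H. card (solutions I a h))"
    by (rule card_UN_disjoint) (use fin disj in \<open>auto simp: solutions_def finite_vectors\<close>)
  finally show ?thesis by (simp add: card_vectors)
qed

lemma card_targets: "finite I \<Longrightarrow> card (I \<rightarrow>\<^sub>E {0..<int p}) = p ^ card I"
  by (simp add: card_PiE)

text \<open>A solvable right-hand side has a solution set of maximal size, which is at least the
  average over all \<open>p ^ card I\<close> right-hand sides.\<close>

lemma card_solutions_ge:
  assumes "finite I" "z \<in> solutions I a h"
  shows "p ^ card K \<le> p ^ card I * card (solutions I a h)"
proof -
  have "p ^ card K \<le> (\<Sum>h'\<in>I \<rightarrow>\<^sub>E {0..<int p}. card (solutions I a h))"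
    unfolding sum_card_solutions[OF assms(1), of a, symmetric]
    by (intro sum_mono card_solutions_le[OF assms(2)])
  then show ?thesis using assms by (simp add: card_targets)
qed

section \<open>Independent tuples and dual families\<close>

lemma indep_subset:
  assumes "indep I a" "J \<subseteq> I" "finite I" shows "indep J a"
  unfolding indep_def
proof (intro allI impI ballI)
  fix l \<alpha> assume l: "\<forall>x. form (comb J l a) x \<doteq> 0" and \<alpha>: "\<alpha> \<in> J"
  let ?l = "\<lambda>\<alpha>. if \<alpha> \<in> J then l \<alpha> else 0"
  have "comb I ?l a = comb J l a" unfolding comb_def
    by (rule ext, rule sum.mono_neutral_cong_right) (use assms in auto)
  then have "?l \<alpha> \<doteq> 0" using assms(1)[unfolded indep_def, rule_format, of ?l \<alpha>] l \<alpha> assms(2) by auto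
  then show "l \<alpha> \<doteq> 0" using \<alpha> by simp
qed

text \<open>Induction in the manner of Gram-Schmidt: projection along the old dual family gives a
  vector on which the old functionals vanish and the new one does not. It is scaled to value 1 and
  then used to correct the old dual vectors.\<close>

lemma indep_dual_basis:
  assumes "finite I" "indep I a"
  shows "\<exists>e. \<forall>\<alpha>\<in>I. \<forall>\<beta>\<in>I. form (a \<alpha>) (e \<beta>) \<doteq> (if \<alpha> = \<beta> then 1 else 0)"
  using assms
proof (induction I)
  case (insert \<gamma> I)
  have "indep I a" using indep_subset[OF insert.prems] insert.hyps by auto
  then obtain e where e: "\<And>\<alpha> \<beta>. \<alpha> \<in> I \<Longrightarrow> \<beta> \<in> I \<Longrightarrow> form (a \<alpha>) (e \<beta>) \<doteq> (if \<alpha> = \<beta> then 1 else 0)"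
    using insert.IH by blast
  \<comment> \<open>With these coefficients the combination pairs with \<open>x\<close> exactly as
    \<open>a \<gamma>\<close> pairs with \<open>proj x\<close> below; it is not in the radical,
    since its coefficient at \<open>\<gamma>\<close> is 1.\<close>
  let ?l = "\<lambda>\<alpha>. if \<alpha> = \<gamma> then 1 else - form (a \<gamma>) (e \<alpha>)"
  have "\<not> ?l \<gamma> \<doteq> 0" using p_ge_2 by (simp add: cong_def)
  then obtain x where x: "\<not> form (comb (insert \<gamma> I) ?l a) x \<doteq> 0"
    using insert.prems[unfolded indep_def, rule_format, of ?l \<gamma>] by blast
  define proj where "proj y = (\<lambda>i. y i - (\<Sum>\<beta>\<in>I. form (a \<beta>) y * e \<beta> i))" for y
  have form_proj: "form z (proj y) = form z y - (\<Sum>\<beta>\<in>I. form (a \<beta>) y * form z (e \<beta>))" for z y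
    by (simp add: proj_def form_diff_right form_sum_right form_scale_right)
  have zero: "form (a \<alpha>) (proj y) \<doteq> 0" if \<alpha>: "\<alpha> \<in> I" for \<alpha> y
  proof -
    have "(\<Sum>\<beta>\<in>I. form (a \<beta>) y * form (a \<alpha>) (e \<beta>)) \<doteq> (\<Sum>\<beta>\<in>I. form (a \<beta>) y * (if \<alpha> = \<beta> then 1 else 0))"
      by (intro cong_sum cong_mult e \<alpha>) auto
    also have "(\<Sum>\<beta>\<in>I. form (a \<beta>) y * (if \<alpha> = \<beta> then 1 else 0)) = (\<Sum>\<beta>\<in>I. if \<beta> = \<alpha> then form (a \<beta>) y else 0)"
      by (rule sum.cong) auto
    also have "\<dots> = form (a \<alpha>) y" using insert.hyps \<alpha> by simp
    finally have "form (a \<alpha>) y - (\<Sum>\<beta>\<in>I. form (a \<beta>) y * form (a \<alpha>) (e \<beta>)) \<doteq> form (a \<alpha>) y - form (a \<alpha>) y"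
      by (intro cong_diff) auto
    then show ?thesis by (simp add: form_proj)
  qed
  have "form (comb (insert \<gamma> I) ?l a) x = form (a \<gamma>) (proj x)"
  proof -
    have "(\<Sum>\<alpha>\<in>I. ?l \<alpha> * form (a \<alpha>) x) = (\<Sum>\<alpha>\<in>I. - (form (a \<alpha>) x * form (a \<gamma>) (e \<alpha>)))"
      by (rule sum.cong) (use insert.hyps in auto)
    then show ?thesis using insert.hyps by (simp add: form_comb form_proj sum_negf)
  qed
  then obtain c where c: "c * form (a \<gamma>) (proj x) \<doteq> 1" using inverse_mod x by metis
  let ?u = "\<lambda>i. c * proj x i"
  have u1: "form (a \<gamma>) ?u \<doteq> 1" using c by (simp add: form_scale_right)
  have u0: "form (a \<alpha>) ?u \<doteq> 0" if "\<alpha> \<in> I" for \<alpha>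
    using cong_scalar_left[OF zero[OF that], of c x] by (simp add: form_scale_right)
  \<comment> \<open>The old dual vectors may pair nontrivially with \<open>a \<gamma>\<close>.
    Subtracting a multiple of \<open>?u\<close> cures this and leaves the other pairings unchanged
    modulo \<open>p\<close>.\<close>
  let ?e = "\<lambda>\<beta>. if \<beta> = \<gamma> then ?u else (\<lambda>i. e \<beta> i - form (a \<gamma>) (e \<beta>) * ?u i)"
  have "form (a \<alpha>) (?e \<beta>) \<doteq> (if \<alpha> = \<beta> then 1 else 0)" if \<alpha>: "\<alpha> \<in> insert \<gamma> I" and \<beta>: "\<beta> \<in> insert \<gamma> I" for \<alpha> \<beta>
  proof (cases "\<beta> = \<gamma>")
    case True
    then show ?thesis using \<alpha> u0 u1 insert.hyps by auto
  next
    case False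
    then have "form (a \<alpha>) (?e \<beta>) = form (a \<alpha>) (e \<beta>) - form (a \<gamma>) (e \<beta>) * form (a \<alpha>) ?u"
      by (simp only: if_False form_diff_right form_scale_right)
    moreover have "form (a \<alpha>) (e \<beta>) - form (a \<gamma>) (e \<beta>) * form (a \<alpha>) ?u \<doteq> (if \<alpha> = \<beta> then 1 else 0)"
    proof (cases "\<alpha> = \<gamma>")
      case True
      have "form (a \<gamma>) (e \<beta>) - form (a \<gamma>) (e \<beta>) * form (a \<gamma>) ?u \<doteq> form (a \<gamma>) (e \<beta>) - form (a \<gamma>) (e \<beta>) * 1"
        by (intro cong_diff cong_mult u1) auto
      then show ?thesis using True False by simp
    next
      case neq: False
      then have "form (a \<alpha>) (e \<beta>) - form (a \<gamma>) (e \<beta>) * form (a \<alpha>) ?u \<doteq> (if \<alpha> = \<beta> then 1 else 0) - form (a \<gamma>) (e \<beta>) * 0"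
        by (intro cong_diff cong_mult u0 e) (use \<alpha> \<beta> False in auto)
      then show ?thesis by simp
    qed
    ultimately show ?thesis by simp
  qed
  then show ?case by (intro exI[of _ ?e] ballI)
qed simp

lemma indep_solvable:
  assumes "finite I" "indep I a"
  shows "\<exists>y. y \<in> solutions I a h"
proof -
  obtain e where e: "\<And>\<alpha> \<beta>. \<alpha> \<in> I \<Longrightarrow> \<beta> \<in> I \<Longrightarrow> form (a \<alpha>) (e \<beta>) \<doteq> (if \<alpha> = \<beta> then 1 else 0)"
    using indep_dual_basis[OF assms] by blast
  let ?y = "\<lambda>i. \<Sum>\<beta>\<in>I. h \<beta> * e \<beta> i"
  have "form (a \<alpha>) (reduce ?y) \<doteq> h \<alpha>" if \<alpha>: "\<alpha> \<in> I" for \<alpha>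
  proof -
    have "form (a \<alpha>) ?y = (\<Sum>\<beta>\<in>I. h \<beta> * form (a \<alpha>) (e \<beta>))"
      by (simp add: form_sum_right form_scale_right)
    moreover have "\<dots> \<doteq> (\<Sum>\<beta>\<in>I. h \<beta> * (if \<alpha> = \<beta> then 1 else 0))"
      by (intro cong_sum cong_mult e \<alpha>) auto
    moreover have "(\<Sum>\<beta>\<in>I. h \<beta> * (if \<alpha> = \<beta> then 1 else 0)) = (\<Sum>\<beta>\<in>I. if \<beta> = \<alpha> then h \<beta> else 0)"
      by (rule sum.cong) auto
    ultimately have "form (a \<alpha>) ?y \<doteq> h \<alpha>" using assms \<alpha> by simp
    then show ?thesis using form_reduce_right cong_trans by blast
  qed
  then have "reduce ?y \<in> solutions I a h" by (simp add: solutions_def)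
  then show ?thesis by blast
qed

text \<open>All right-hand sides are solvable, so all \<open>p ^ card I\<close> solution sets have
  the same size.\<close>

lemma card_solutions_indep:
  assumes "finite I" "indep I a"
  shows "p ^ card I * card (solutions I a h) = p ^ card K"
proof -
  have eq: "card (solutions I a h) = card (solutions I a h')" for h'
    using card_solutions_le indep_solvable[OF assms] by (meson le_antisym)
  have "(\<Sum>h'\<in>I \<rightarrow>\<^sub>E {0..<int p}. card (solutions I a h)) = p ^ card K"
    unfolding sum_card_solutions[OF assms(1), of a, symmetric] by (rule sum.cong[OF refl eq])
  then have "card (I \<rightarrow>\<^sub>E {0..<int p}) * card (solutions I a h) = p ^ card K"
    by (simp only: sum_constant of_nat_id)
  then show ?thesis by (simp only: card_targets[OF assms(1)])
qed


section \<open>Solutions that depend on the tuple\<close>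

lemma form_comb_add: "form (comb I (\<lambda>\<alpha>. l \<alpha> + m \<alpha>) a) x = form (comb I l a) x + form (comb I m a) x"
  and form_comb_diff: "form (comb I (\<lambda>\<alpha>. l \<alpha> - m \<alpha>) a) x = form (comb I l a) x - form (comb I m a) x"
  by (simp_all add: form_comb ring_distribs sum.distrib left_diff_distrib sum_subtractf)

lemma form_comb_right: "form z (comb I l a) \<doteq> (\<Sum>\<alpha>\<in>I. l \<alpha> * form z (a \<alpha>))"
proof -
  have "form z (comb I l a) \<doteq> - (\<Sum>\<alpha>\<in>I. l \<alpha> * form (a \<alpha>) z)"
    using form_neg[of z "comb I l a"] by (simp add: form_comb)
  also have "- (\<Sum>\<alpha>\<in>I. l \<alpha> * form (a \<alpha>) z) = (\<Sum>\<alpha>\<in>I. l \<alpha> * - form (a \<alpha>) z)" by (simp add: sum_negf)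
  also have "(\<Sum>\<alpha>\<in>I. l \<alpha> * - form (a \<alpha>) z) \<doteq> (\<Sum>\<alpha>\<in>I. l \<alpha> * form z (a \<alpha>))"
    by (intro cong_sum cong_mult cong_sym[OF form_neg]) auto
  finally show ?thesis .
qed

lemma comb_cong:
  assumes "\<And>\<alpha>. \<alpha> \<in> I \<Longrightarrow> l \<alpha> \<doteq> m \<alpha>" shows "comb I l a i \<doteq> comb I m a i"
  unfolding comb_def by (intro cong_sum cong_mult assms) auto

text \<open>Over independent tuples with equal Gram matrices the dependent solutions correspond under
  \<open>\<Sum> c\<^sub>\<alpha> a\<^sub>\<alpha> + r \<mapsto> \<Sum> c\<^sub>\<alpha> a0\<^sub>\<alpha> + r\<close>, with \<open>r\<close> in the radical of the form.\<close>

lemma card_dependent_le: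
  assumes "finite I" and a: "indep I a" and a0: "indep I a0"
    and gram: "\<And>\<alpha> \<beta>. \<alpha> \<in> I \<Longrightarrow> \<beta> \<in> I \<Longrightarrow> form (a \<alpha>) (a \<beta>) \<doteq> form (a0 \<alpha>) (a0 \<beta>)"
  shows "card {y \<in> solutions I a h. dependent_on I a y} \<le> card {y \<in> solutions I a0 h. dependent_on I a0 y}"
proof -
  \<comment> \<open>One choice of coefficients for each dependent \<open>y\<close>; the remainder
    \<open>y - comb I (c y) a\<close> lies in the radical.\<close>
  define c where "c y = (SOME l. \<forall>x. form y x \<doteq> form (comb I l a) x)" for y
  let ?f = "\<lambda>y. reduce (\<lambda>i. y i - comb I (c y) a i + comb I (c y) a0 i)"
  have c: "form y x \<doteq> form (comb I (c y) a) x" if "dependent_on I a y" for x y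
    using someI_ex[OF that[unfolded dependent_on_def]] unfolding c_def by blast
  have f_left: "form (?f y) x \<doteq> form (comb I (c y) a0) x" if "dependent_on I a y" for x y
  proof -
    have "form y x - form (comb I (c y) a) x + form (comb I (c y) a0) x
        \<doteq> form (comb I (c y) a) x - form (comb I (c y) a) x + form (comb I (c y) a0) x"
      by (intro cong_add cong_diff c that) auto
    then show ?thesis
      using form_reduce_left[of "\<lambda>i. y i - comb I (c y) a i + comb I (c y) a0 i" x]
      unfolding form_add_left form_diff_left using cong_trans by fastforce
  qed
  show ?thesis
  proof (rule card_inj_on_le[of ?f])
    show "inj_on ?f {y \<in> solutions I a h. dependent_on I a y}"
    proof (rule inj_onI)
      fix y y' assume y: "y \<in> {y \<in> solutions I a h. dependent_on I a y}"
        and y': "y' \<in> {y \<in> solutions I a h. dependent_on I a y}" and eq: "?f y = ?f y'"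
      \<comment> \<open>The image determines the coefficients modulo \<open>p\<close> because
        \<open>a0\<close> is independent, and then the remainder of \<open>y\<close> as
        well.\<close>
      have "form (comb I (c y) a0) x \<doteq> form (comb I (c y') a0) x" for x
        using f_left[of y x] f_left[of y' x] y y' eq by (auto simp: cong_def)
      then have "form (comb I (\<lambda>\<alpha>. c y \<alpha> - c y' \<alpha>) a0) x \<doteq> 0" for x
        by (simp add: form_comb_diff cong_iff_dvd_diff)
      then have cc: "c y \<alpha> \<doteq> c y' \<alpha>" if "\<alpha> \<in> I" for \<alpha>
        using a0 that unfolding indep_def by (metis cong_diff_iff_cong_0)
      show "y = y'"
      proof (rule vectors_eqI)
        fix i assume i: "i \<in> K"
        have "y i - comb I (c y) a i + comb I (c y) a0 i \<doteq> y' i - comb I (c y') a i + comb I (c y') a0 i"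
          using fun_cong[OF eq, of i] i by (simp add: reduce_def cong_def)
        then have "(y i - comb I (c y) a i + comb I (c y) a0 i) + comb I (c y) a i - comb I (c y) a0 i
          \<doteq> (y' i - comb I (c y') a i + comb I (c y') a0 i) + comb I (c y') a i - comb I (c y') a0 i"
          by (rule cong_diff[OF cong_add[OF _ comb_cong[OF cc]] comb_cong[OF cc]])
        then show "y i \<doteq> y' i" by simp
      qed (use y y' in \<open>auto simp: solutions_def\<close>)
    qed
    show "?f ` {y \<in> solutions I a h. dependent_on I a y} \<subseteq> {y \<in> solutions I a0 h. dependent_on I a0 y}"
    proof clarify
      fix y assume y: "y \<in> solutions I a h" and dep: "dependent_on I a y"
      have "form (a0 \<alpha>) (?f y) \<doteq> h \<alpha>" if \<alpha>: "\<alpha> \<in> I" for \<alpha>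
      proof -
        \<comment> \<open>The pairing is expanded in the coefficients, the Gram entries of
          \<open>a0\<close> are replaced by those of \<open>a\<close>, and the sum is folded back to
          \<open>form (a \<alpha>) y\<close>.\<close>
        have "form (a0 \<alpha>) (?f y) \<doteq> - form (?f y) (a0 \<alpha>)" by (rule form_neg)
        also have "- form (?f y) (a0 \<alpha>) \<doteq> - form (comb I (c y) a0) (a0 \<alpha>)"
          using f_left[OF dep] by (simp add: cong_minus_minus_iff)
        also have "form (comb I (c y) a0) (a0 \<alpha>) = (\<Sum>\<beta>\<in>I. c y \<beta> * form (a0 \<beta>) (a0 \<alpha>))" by (rule form_comb)
        also have "- (\<Sum>\<beta>\<in>I. c y \<beta> * form (a0 \<beta>) (a0 \<alpha>)) \<doteq> - (\<Sum>\<beta>\<in>I. c y \<beta> * form (a \<beta>) (a \<alpha>))"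
          unfolding cong_minus_minus_iff by (intro cong_sum cong_mult cong_sym[OF gram] \<alpha>) auto
        also have "(\<Sum>\<beta>\<in>I. c y \<beta> * form (a \<beta>) (a \<alpha>)) = form (comb I (c y) a) (a \<alpha>)" by (rule form_comb[symmetric])
        also have "- form (comb I (c y) a) (a \<alpha>) \<doteq> - form y (a \<alpha>)"
          using c[OF dep] by (simp add: cong_minus_minus_iff cong_sym)
        also have "- form y (a \<alpha>) \<doteq> form (a \<alpha>) y" by (rule cong_sym[OF form_neg])
        also have "form (a \<alpha>) y \<doteq> h \<alpha>" using y \<alpha> by (simp add: solutions_def)
        finally show ?thesis .
      qed
      then show "?f y \<in> solutions I a0 h \<and> dependent_on I a0 (?f y)"
        using f_left[OF dep] by (auto simp: solutions_def dependent_on_def)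
    qed
  qed (auto simp: solutions_def finite_vectors)
qed

text \<open>Translation by the difference of \<open>z\<close> and a dependent solution
  \<open>b\<close> sends dependent solutions injectively to solutions that are not dependent;
  otherwise \<open>z\<close> would be dependent.\<close>

lemma card_dependent_le_half:
  assumes z: "z \<in> solutions I a h" "\<not> dependent_on I a z"
  shows "2 * card {y \<in> solutions I a h. dependent_on I a y} \<le> card (solutions I a h)"
proof -
  let ?S = "solutions I a h" and ?B = "{y \<in> solutions I a h. dependent_on I a y}"
  have fin: "finite ?S" using finite_vectors by (simp add: solutions_def)
  have "card ?B \<le> card (?S - ?B)"
  proof (cases "?B = {}")
    case False
    then obtain b where b: "b \<in> ?S" "dependent_on I a b" by auto
    let ?f = "\<lambda>y. reduce (\<lambda>i. y i - b i + z i)"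
    show ?thesis
    proof (rule card_inj_on_le[of ?f])
      show "inj_on ?f ?B"
      proof (rule inj_onI)
        fix x y assume *: "x \<in> ?B" "y \<in> ?B" "?f x = ?f y"
        show "x = y"
        proof (rule vectors_eqI)
          fix i assume i: "i \<in> K"
          have "x i - b i + z i \<doteq> y i - b i + z i"
            using fun_cong[OF *(3), of i] i by (simp add: reduce_def cong_def)
          then show "x i \<doteq> y i" by (simp add: cong_iff_dvd_diff)
        qed (use * in \<open>auto simp: solutions_def\<close>)
      qed
      show "?f ` ?B \<subseteq> ?S - ?B"
      proof clarify
        fix y assume y: "y \<in> ?S" "dependent_on I a y"
        have "form (a \<alpha>) (?f y) \<doteq> h \<alpha>" if "\<alpha> \<in> I" for \<alpha>
        proof -
          have "form (a \<alpha>) y - form (a \<alpha>) b + form (a \<alpha>) z \<doteq> h \<alpha> - h \<alpha> + h \<alpha>"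
            by (intro cong_add cong_diff) (use y b z that in \<open>auto simp: solutions_def\<close>)
          then show ?thesis using form_reduce_right[of "a \<alpha>" "\<lambda>i. y i - b i + z i"]
            unfolding form_add_right form_diff_right using cong_trans by fastforce
        qed
        moreover have "\<not> dependent_on I a (?f y)"
        proof
          assume "dependent_on I a (?f y)"
          then obtain l where l: "\<And>x. form (?f y) x \<doteq> form (comb I l a) x" by (auto simp: dependent_on_def)
          obtain m where m: "\<And>x. form y x \<doteq> form (comb I m a) x" using y by (auto simp: dependent_on_def)
          obtain n where n: "\<And>x. form b x \<doteq> form (comb I n a) x" using b by (auto simp: dependent_on_def)
          have "form z x \<doteq> form (comb I (\<lambda>\<alpha>. l \<alpha> - m \<alpha> + n \<alpha>) a) x" for x
          proof -
            have "form y x - form b x + form z x \<doteq> form (comb I l a) x"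
              using l[of x] form_reduce_left[of "\<lambda>i. y i - b i + z i" x]
              unfolding form_add_left form_diff_left by (metis cong_sym cong_trans)
            then have "(form y x - form b x + form z x) - form y x + form b x
              \<doteq> form (comb I l a) x - form (comb I m a) x + form (comb I n a) x"
              by (intro cong_add cong_diff m n)
            then show ?thesis by (simp add: form_comb_add form_comb_diff)
          qed
          then show False using z by (auto simp: dependent_on_def)
        qed
        ultimately show "?f y \<in> ?S - ?B" by (simp add: solutions_def)
      qed
    qed (use fin in auto)
  next
    case True
    then show ?thesis by (simp only: card.empty le0)
  qed
  moreover have "card (?S - ?B) = card ?S - card ?B" "card ?B \<le> card ?S"
    using fin by (auto intro!: card_Diff_subset card_mono)
  ultimately show ?thesis by linarith
qed

text \<open>The vector \<open>z\<close> shows that at most half of the solutions over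
  \<open>a0\<close> are dependent. The solution sets over \<open>a\<close> and \<open>a0\<close>
  have equal size, so \<open>card_dependent_le\<close> transfers this to \<open>a\<close>.\<close>

lemma card_independent_ge:
  assumes "finite I" and a: "indep I a" and a0: "indep I a0"
    and gram: "\<And>\<alpha> \<beta>. \<alpha> \<in> I \<Longrightarrow> \<beta> \<in> I \<Longrightarrow> form (a \<alpha>) (a \<beta>) \<doteq> form (a0 \<alpha>) (a0 \<beta>)"
    and z: "z \<in> solutions I a0 h" "\<not> dependent_on I a0 z"
  shows "p ^ card K \<le> p ^ Suc (card I) * card {y \<in> solutions I a h. \<not> dependent_on I a y}"
proof -
  let ?S = "solutions I a h" and ?B = "{y \<in> solutions I a h. dependent_on I a y}"
  have fin: "finite ?S" using finite_vectors by (simp add: solutions_def)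
  have "p ^ card I * card ?S = p ^ card I * card (solutions I a0 h)"
    using card_solutions_indep[OF assms(1)] a a0 by metis
  then have "card ?S = card (solutions I a0 h)" using p_ge_2 by simp
  then have "2 * card ?B \<le> card ?S"
    using card_dependent_le[OF assms(1) a a0 gram, of h] card_dependent_le_half[OF z] by linarith
  moreover have "{y \<in> ?S. \<not> dependent_on I a y} = ?S - ?B" by auto
  moreover have "card (?S - ?B) = card ?S - card ?B" using fin by (auto intro!: card_Diff_subset)
  ultimately have "card ?S \<le> 2 * card {y \<in> ?S. \<not> dependent_on I a y}" by simp
  \<comment> \<open>The factor 2 is weakened to \<open>p\<close>, which keeps all bounds powers of
    \<open>p\<close>; this is the \<open>Suc\<close> in the exponent.\<close>
  also have "\<dots> \<le> p * card {y \<in> ?S. \<not> dependent_on I a y}" using p_ge_2 by simp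
  finally have "p ^ card I * card ?S \<le> p ^ card I * (p * card {y \<in> ?S. \<not> dependent_on I a y})"
    by (rule mult_le_mono2)
  then show ?thesis using card_solutions_indep[OF assms(1) a] by (simp add: mult_ac)
qed

section \<open>Extending tuples by one vector\<close>

lemma comb_fun_upd: "finite I \<Longrightarrow> \<gamma> \<notin> I \<Longrightarrow> comb (insert \<gamma> I) l (a(\<gamma> := y)) i = l \<gamma> * y i + comb I l a i"
  by (simp add: comb_def) (rule sum.cong, auto)

text \<open>In a relation, a coefficient of \<open>y\<close> invertible modulo \<open>p\<close>
  would make \<open>y\<close> dependent on \<open>a\<close>. So it vanishes, and what remains is a
  relation within \<open>a\<close>.\<close>

lemma indep_extend:
  assumes I: "finite I" "\<gamma> \<notin> I" and a: "indep I a" and y: "\<not> dependent_on I a y"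
  shows "indep (insert \<gamma> I) (a(\<gamma> := y))"
  unfolding indep_def
proof (intro allI impI)
  fix l assume "\<forall>x. form (comb (insert \<gamma> I) l (a(\<gamma> := y))) x \<doteq> 0"
  moreover have "comb (insert \<gamma> I) l (a(\<gamma> := y)) = (\<lambda>i. l \<gamma> * y i + comb I l a i)"
    by (rule ext) (rule comb_fun_upd[OF I])
  ultimately have 0: "l \<gamma> * form y x + form (comb I l a) x \<doteq> 0" for x
    by (simp add: form_add_left form_scale_left)
  have "l \<gamma> \<doteq> 0"
  proof (rule ccontr)
    assume "\<not> l \<gamma> \<doteq> 0"
    then obtain c where c: "c * l \<gamma> \<doteq> 1" using inverse_mod by blast
    have "form y x \<doteq> form (comb I (\<lambda>\<alpha>. - c * l \<alpha>) a) x" for x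
    proof -
      have "c * l \<gamma> * form y x \<doteq> 1 * form y x" by (intro cong_mult c) auto
      moreover have "c * (l \<gamma> * form y x + form (comb I l a) x) \<doteq> c * 0" by (intro cong_mult 0) auto
      moreover have "form (comb I (\<lambda>\<alpha>. - c * l \<alpha>) a) x = - c * form (comb I l a) x"
        by (simp add: form_comb sum_distrib_left mult_ac sum_negf)
      ultimately have "c * (l \<gamma> * form y x + form (comb I l a) x) - c * l \<gamma> * form y x \<doteq> c * 0 - 1 * form y x"
        by (intro cong_diff)
      then have "c * form (comb I l a) x \<doteq> - form y x" by (simp add: algebra_simps)
      then have "- (c * form (comb I l a) x) \<doteq> - (- form y x)" by (simp only: cong_minus_minus_iff)
      then show ?thesis using \<open>form (comb I (\<lambda>\<alpha>. - c * l \<alpha>) a) x = _\<close> by (simp add: cong_sym)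
    qed
    then show False using y by (auto simp: dependent_on_def)
  qed
  moreover have "l \<alpha> \<doteq> 0" if "\<alpha> \<in> I" for \<alpha>
  proof -
    have "form (comb I l a) x \<doteq> 0" for x
      using 0[of x] cong_mult[OF \<open>l \<gamma> \<doteq> 0\<close> cong_refl[of "form y x"]]
      by (simp add: cong_0_iff dvd_add_right_iff)
    then show ?thesis using a that by (simp add: indep_def)
  qed
  ultimately show "\<forall>\<alpha>\<in>insert \<gamma> I. l \<alpha> \<doteq> 0" by auto
qed

lemma indep_not_dependent:
  assumes I: "finite I" "\<gamma> \<notin> I" and a: "indep (insert \<gamma> I) a"
  shows "\<not> dependent_on I a (a \<gamma>)"
proof
  assume "dependent_on I a (a \<gamma>)"
  then obtain l where l: "\<And>x. form (a \<gamma>) x \<doteq> form (comb I l a) x" by (auto simp: dependent_on_def)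
  let ?l = "l(\<gamma> := -1)"
  have "comb I ?l a = comb I l a" unfolding comb_def by (rule ext, rule sum.cong) (use I in auto)
  then have "form (comb (insert \<gamma> I) ?l a) x = - form (a \<gamma>) x + form (comb I l a) x" for x
    using I form_comb[of "insert \<gamma> I" ?l a x] form_comb[of I ?l a x] by simp
  then have "form (comb (insert \<gamma> I) ?l a) x \<doteq> 0" for x
    using l[of x] by (simp add: cong_iff_dvd_diff dvd_diff_commute)
  then have "?l \<gamma> \<doteq> 0" using a[unfolded indep_def, rule_format, of ?l \<gamma>] by blast
  then show False using p_ge_2 by (simp add: cong_iff_dvd_diff)
qed

lemma indep_cong:
  assumes "\<And>\<alpha>. \<alpha> \<in> I \<Longrightarrow> a \<alpha> = b \<alpha>" shows "indep I a \<longleftrightarrow> indep I b"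
proof -
  have "comb I l a = comb I l b" for l unfolding comb_def by (rule ext, rule sum.cong) (use assms in auto)
  then show ?thesis by (simp add: indep_def)
qed

lemma finite_gram_tuples: "finite I \<Longrightarrow> finite (gram_tuples I g)"
  unfolding gram_tuples_def by (rule finite_subset[of _ "I \<rightarrow>\<^sub>E vectors"]) (auto simp: finite_PiE finite_vectors)

text \<open>Only the pairs with \<open>\<gamma>\<close> on the right are imposed on
  \<open>y\<close>. The tuple \<open>b\<close> shows that \<open>g\<close> is alternating modulo
  \<open>p\<close>, which yields the reversed pairs and the diagonal one.\<close>

lemma gram_tuples_extend:
  assumes \<gamma>: "\<gamma> \<notin> I" and b: "b \<in> gram_tuples (insert \<gamma> I) g"
    and a: "a \<in> gram_tuples I g" and y: "y \<in> solutions I a (\<lambda>\<alpha>. g \<alpha> \<gamma>)"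
  shows "a(\<gamma> := y) \<in> gram_tuples (insert \<gamma> I) g"
proof -
  have b': "g \<alpha> \<beta> \<doteq> form (b \<alpha>) (b \<beta>)" if "\<alpha> \<in> insert \<gamma> I" "\<beta> \<in> insert \<gamma> I" for \<alpha> \<beta>
    using b that by (auto simp: gram_tuples_def cong_sym)
  have "form y (a \<alpha>) \<doteq> g \<gamma> \<alpha>" if \<alpha>: "\<alpha> \<in> I" for \<alpha>
  proof -
    have "form y (a \<alpha>) \<doteq> - form (a \<alpha>) y" by (rule form_neg)
    also have "- form (a \<alpha>) y \<doteq> - g \<alpha> \<gamma>" using y \<alpha> by (simp add: solutions_def cong_minus_minus_iff)
    also have "- g \<alpha> \<gamma> \<doteq> - form (b \<alpha>) (b \<gamma>)" using b'[of \<alpha> \<gamma>] \<alpha> by (simp add: cong_minus_minus_iff)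
    also have "- form (b \<alpha>) (b \<gamma>) \<doteq> form (b \<gamma>) (b \<alpha>)" by (rule cong_sym[OF form_neg])
    also have "form (b \<gamma>) (b \<alpha>) \<doteq> g \<gamma> \<alpha>" using b'[of \<gamma> \<alpha>] \<alpha> by (simp add: cong_sym)
    finally show ?thesis .
  qed
  moreover have "form y y \<doteq> g \<gamma> \<gamma>"
    using form_self[of y] form_self[of "b \<gamma>"] b'[of \<gamma> \<gamma>] by (metis cong_sym cong_trans insertI1)
  moreover have "a(\<gamma> := y) \<in> insert \<gamma> I \<rightarrow>\<^sub>E vectors"
    using a y \<gamma> by (auto simp: gram_tuples_def solutions_def PiE_iff extensional_def)
  ultimately show ?thesis using a y \<gamma> by (auto simp: gram_tuples_def solutions_def)
qed

text \<open>The pairs of a tuple \<open>a\<close> and an extension \<open>y\<close> embed in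
  \<open>T\<close>. The estimate with \<open>n\<close> and \<open>m\<close> bounds
  \<open>card (Y a)\<close> below by \<open>n / m\<close> without division.\<close>

lemma card_extend:
  assumes I: "finite I" "\<gamma> \<notin> I" and A: "A \<subseteq> I \<rightarrow>\<^sub>E vectors" and T: "finite T"
    and ext: "\<And>a y. a \<in> A \<Longrightarrow> y \<in> Y a \<Longrightarrow> a(\<gamma> := y) \<in> T"
    and Y: "\<And>a. a \<in> A \<Longrightarrow> n \<le> m * card (Y a)" "\<And>a. a \<in> A \<Longrightarrow> finite (Y a)"
  shows "n * card A \<le> m * card T"
proof -
  have finA: "finite A" by (rule finite_subset[OF A]) (use I in \<open>auto simp: finite_PiE finite_vectors\<close>)
  have "card (Sigma A Y) \<le> card T"
  proof (rule card_inj_on_le[of "\<lambda>(a, y). a(\<gamma> := y)"])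
    show "inj_on (\<lambda>(a, y). a(\<gamma> := y)) (Sigma A Y)"
    proof (rule inj_onI, clarify)
      fix a y a' y' assume *: "a \<in> A" "a' \<in> A" and eq: "a(\<gamma> := y) = a'(\<gamma> := y')"
      have "a = a'"
      proof (rule PiE_ext)
        show "a \<in> I \<rightarrow>\<^sub>E vectors" "a' \<in> I \<rightarrow>\<^sub>E vectors" using * A by auto
        show "a \<alpha> = a' \<alpha>" if "\<alpha> \<in> I" for \<alpha> using fun_cong[OF eq, of \<alpha>] that I(2) by (auto split: if_splits)
      qed
      then show "a = a' \<and> y = y'" using fun_cong[OF eq, of \<gamma>] by simp
    qed
  qed (use T ext in auto)
  have "n * card A = (\<Sum>a\<in>A. n)" by simp
  also have "\<dots> \<le> (\<Sum>a\<in>A. m * card (Y a))" by (rule sum_mono) (rule Y)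
  also have "\<dots> = m * card (Sigma A Y)" using finA Y by (simp add: card_SigmaI sum_distrib_left)
  also have "\<dots> \<le> m * card T" using \<open>card (Sigma A Y) \<le> card T\<close> by simp
  finally show ?thesis .
qed

text \<open>The restriction of \<open>b\<close> extends independently by \<open>b \<gamma>\<close>,
  so \<open>card_independent_ge\<close> applies to every independent tuple with the same Gram
  matrix. A vector added to \<open>n\<close> others costs a factor \<open>p ^ Suc n\<close>; these
  exponents sum to \<open>\<Sum>{..card I}\<close>.\<close>

lemma card_indep_gram_tuples:
  assumes "finite I" "b \<in> gram_tuples I g" "indep I b"
  shows "p ^ (card K * card I) \<le> p ^ (\<Sum>{..card I}) * card {a \<in> gram_tuples I g. indep I a}"
  using assms
proof (induction I arbitrary: b)
  case empty
  have "{a \<in> gram_tuples {} g. indep {} a} = {\<lambda>_. undefined}" by (auto simp: gram_tuples_def indep_def)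
  then show ?case by simp
next
  case (insert \<gamma> I)
  let ?A = "{a \<in> gram_tuples I g. indep I a}" and ?T = "{a \<in> gram_tuples (insert \<gamma> I) g. indep (insert \<gamma> I) a}"
  have b_indep: "indep I b" by (rule indep_subset[OF insert.prems(2)]) (use insert.hyps in auto)
  have bI: "restrict b I \<in> gram_tuples I g" using insert.prems by (auto simp: gram_tuples_def)
  moreover have "indep I (restrict b I)" using indep_cong[of I "restrict b I" b] b_indep by simp
  ultimately have IH: "p ^ (card K * card I) \<le> p ^ (\<Sum>{..card I}) * card ?A" by (rule insert.IH)
  let ?Y = "\<lambda>a. {y \<in> solutions I a (\<lambda>\<alpha>. g \<alpha> \<gamma>). \<not> dependent_on I a y}"
  have "p ^ card K * card ?A \<le> p ^ Suc (card I) * card ?T"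
  proof (rule card_extend[OF insert.hyps])
    show "?A \<subseteq> I \<rightarrow>\<^sub>E vectors" by (auto simp: gram_tuples_def)
    show "finite ?T" by (rule finite_subset[OF _ finite_gram_tuples[of "insert \<gamma> I" g]]) (use insert.hyps in auto)
    show "a(\<gamma> := y) \<in> ?T" if "a \<in> ?A" "y \<in> ?Y a" for a y
      using gram_tuples_extend[OF insert.hyps(2) insert.prems(1), of a y] indep_extend[OF insert.hyps, of a y] that by blast
    show "finite (?Y a)" for a by (simp add: solutions_def finite_vectors)
    show "p ^ card K \<le> p ^ Suc (card I) * card (?Y a)" if a: "a \<in> ?A" for a
    proof (rule card_independent_ge[OF insert.hyps(1) _ b_indep])
      show "indep I a" using a by simp
      show "form (a \<alpha>) (a \<beta>) \<doteq> form (b \<alpha>) (b \<beta>)" if "\<alpha> \<in> I" "\<beta> \<in> I" for \<alpha> \<beta>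
        using a insert.prems(1) that by (auto simp: gram_tuples_def cong_def)
      show "b \<gamma> \<in> solutions I b (\<lambda>\<alpha>. g \<alpha> \<gamma>)" using insert.prems(1) by (auto simp: solutions_def gram_tuples_def)
      show "\<not> dependent_on I b (b \<gamma>)" by (rule indep_not_dependent[OF insert.hyps insert.prems(2)])
    qed
  qed
  note step = this
  have "p ^ (card K * card (insert \<gamma> I)) = p ^ card K * p ^ (card K * card I)"
    using insert.hyps by (simp add: power_add)
  also have "\<dots> \<le> p ^ card K * (p ^ (\<Sum>{..card I}) * card ?A)" using IH by (rule mult_le_mono2)
  also have "\<dots> = p ^ (\<Sum>{..card I}) * (p ^ card K * card ?A)" by (rule mult.left_commute)
  also have "\<dots> \<le> p ^ (\<Sum>{..card I}) * (p ^ Suc (card I) * card ?T)" using step by (rule mult_le_mono2)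
  also have "\<dots> = p ^ (\<Sum>{..card (insert \<gamma> I)}) * card ?T" using insert.hyps by (simp add: power_add)
  finally show ?case .
qed

text \<open>The induction is over proper subsets because the member dropped in the dependent case is
  dictated by the relation found.\<close>

theorem card_gram_tuples:
  assumes "finite I" "gram_tuples I g \<noteq> {}"
  shows "p ^ (card K * card I) \<le> p ^ (\<Sum>{..card I}) * card (gram_tuples I g)"
  using assms
proof (induction I rule: finite_psubset_induct)
  case (psubset I)
  show ?case
  proof (cases "\<forall>a\<in>gram_tuples I g. indep I a")
    case True
    then have "{a \<in> gram_tuples I g. indep I a} = gram_tuples I g" by auto
    moreover obtain b where "b \<in> gram_tuples I g" using psubset.prems by blast
    ultimately show ?thesis using True card_indep_gram_tuples[OF psubset.hyps, of b g] by simp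
  next
    case False
    then obtain b l \<gamma> where b: "b \<in> gram_tuples I g" and l: "\<And>x. form (comb I l b) x \<doteq> 0"
      and \<gamma>: "\<gamma> \<in> I" "\<not> l \<gamma> \<doteq> 0" unfolding indep_def by auto
    define J where "J = I - {\<gamma>}"
    have J: "finite J" "\<gamma> \<notin> J" "insert \<gamma> J = I" using \<gamma> psubset.hyps by (auto simp: J_def)
    have "restrict b J \<in> gram_tuples J g" using b J by (auto simp: gram_tuples_def)
    then have IH: "p ^ (card K * card J) \<le> p ^ (\<Sum>{..card J}) * card (gram_tuples J g)"
      using psubset.IH[of J] J by blast
    obtain c where c: "c * l \<gamma> \<doteq> 1" using inverse_mod \<gamma> by blast
    \<comment> \<open>The relation satisfied by \<open>b\<close> becomes a relation between entries
      of \<open>g\<close>, hence is available for every tuple with Gram matrix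
      \<open>g\<close>.\<close>
    have g: "(\<Sum>\<alpha>\<in>J. (- c * l \<alpha>) * g \<beta> \<alpha>) \<doteq> g \<beta> \<gamma>" if \<beta>: "\<beta> \<in> J" for \<beta>
    proof -
      have "(\<Sum>\<alpha>\<in>I. l \<alpha> * g \<beta> \<alpha>) \<doteq> (\<Sum>\<alpha>\<in>I. l \<alpha> * form (b \<beta>) (b \<alpha>))"
        by (intro cong_sum cong_mult) (use b \<beta> J in \<open>auto simp: gram_tuples_def cong_sym\<close>)
      also have "(\<Sum>\<alpha>\<in>I. l \<alpha> * form (b \<beta>) (b \<alpha>)) \<doteq> form (b \<beta>) (comb I l b)" by (rule cong_sym[OF form_comb_right])
      also have "form (b \<beta>) (comb I l b) \<doteq> - form (comb I l b) (b \<beta>)" by (rule form_neg)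
      also have "- form (comb I l b) (b \<beta>) \<doteq> - 0" using l by (simp only: cong_minus_minus_iff)
      finally have "l \<gamma> * g \<beta> \<gamma> + (\<Sum>\<alpha>\<in>J. l \<alpha> * g \<beta> \<alpha>) \<doteq> 0" by (simp only: J(3)[symmetric] sum.insert[OF J(1,2)] minus_zero)
      then have "- c * (l \<gamma> * g \<beta> \<gamma> + (\<Sum>\<alpha>\<in>J. l \<alpha> * g \<beta> \<alpha>)) + c * l \<gamma> * g \<beta> \<gamma> \<doteq> - c * 0 + 1 * g \<beta> \<gamma>"
        by (intro cong_add cong_mult c) auto
      then show ?thesis by (simp add: algebra_simps sum_distrib_left sum_negf)
    qed
    have "p ^ card K * card (gram_tuples J g) \<le> p ^ card J * card (gram_tuples I g)"
    proof (rule card_extend[OF J(1,2)])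
      show "gram_tuples J g \<subseteq> J \<rightarrow>\<^sub>E vectors" by (auto simp: gram_tuples_def)
      show "finite (gram_tuples I g)" using finite_gram_tuples psubset.hyps by auto
      show "a(\<gamma> := y) \<in> gram_tuples I g" if "a \<in> gram_tuples J g" "y \<in> solutions J a (\<lambda>\<alpha>. g \<alpha> \<gamma>)" for a y
        using gram_tuples_extend[OF J(2) _ that] b J(3) by simp
      show "finite (solutions J a (\<lambda>\<alpha>. g \<alpha> \<gamma>))" for a by (simp add: solutions_def finite_vectors)
      show "p ^ card K \<le> p ^ card J * card (solutions J a (\<lambda>\<alpha>. g \<alpha> \<gamma>))" if a: "a \<in> gram_tuples J g" for a
      proof (rule card_solutions_ge[OF J(1)])
        \<comment> \<open>The combination that expresses \<open>b \<gamma>\<close> through the other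
          members of \<open>b\<close> modulo the radical, formed with the members of
          \<open>a\<close> instead.\<close>
        let ?y = "comb J (\<lambda>\<alpha>. - c * l \<alpha>) a"
        have "form (a \<beta>) (reduce ?y) \<doteq> g \<beta> \<gamma>" if \<beta>: "\<beta> \<in> J" for \<beta>
        proof -
          have "form (a \<beta>) (reduce ?y) \<doteq> form (a \<beta>) ?y" by (rule form_reduce_right)
          also have "form (a \<beta>) ?y \<doteq> (\<Sum>\<alpha>\<in>J. (- c * l \<alpha>) * form (a \<beta>) (a \<alpha>))" by (rule form_comb_right)
          also have "(\<Sum>\<alpha>\<in>J. (- c * l \<alpha>) * form (a \<beta>) (a \<alpha>)) \<doteq> (\<Sum>\<alpha>\<in>J. (- c * l \<alpha>) * g \<beta> \<alpha>)"
            by (intro cong_sum cong_mult) (use a \<beta> in \<open>auto simp: gram_tuples_def\<close>)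
          also have "(\<Sum>\<alpha>\<in>J. (- c * l \<alpha>) * g \<beta> \<alpha>) \<doteq> g \<beta> \<gamma>" by (rule g[OF \<beta>])
          finally show ?thesis .
        qed
        then show "reduce ?y \<in> solutions J a (\<lambda>\<alpha>. g \<alpha> \<gamma>)" by (simp add: solutions_def)
      qed
    qed
    note step = this
    have cI: "card I = Suc (card J)" using card_insert_disjoint[OF J(1,2)] J(3) by simp
    have "p ^ (card K * card I) = p ^ card K * p ^ (card K * card J)" by (simp add: cI power_add)
    also have "\<dots> \<le> p ^ card K * (p ^ (\<Sum>{..card J}) * card (gram_tuples J g))" using IH by (rule mult_le_mono2)
    also have "\<dots> = p ^ (\<Sum>{..card J}) * (p ^ card K * card (gram_tuples J g))" by (rule mult.left_commute)
    also have "\<dots> \<le> p ^ (\<Sum>{..card J}) * (p ^ card J * card (gram_tuples I g))" using step by (rule mult_le_mono2)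
    \<comment> \<open>The extension costs only \<open>p ^ card J\<close>, so a spare factor
      \<open>p\<close> is given away.\<close>
    also have "\<dots> \<le> p ^ (\<Sum>{..card I}) * card (gram_tuples I g)"
      using p_ge_2 by (simp add: cI power_add)
    finally show ?thesis .
  qed
qed

end

section \<open>Normal forms in groups of class 2\<close>

lemma (in group) commutator_eqI:
  assumes "a \<in> carrier G" "b \<in> carrier G" "c \<in> carrier G" and "b \<otimes> a \<otimes> c = a \<otimes> b"
  shows "commutator G a b = c"
proof -
  have "commutator G a b = inv (b \<otimes> a) \<otimes> (a \<otimes> b)"
    using assms by (simp add: commutator_def inv_mult_group m_assoc)
  also have "\<dots> = inv (b \<otimes> a) \<otimes> (b \<otimes> a \<otimes> c)" by (simp only: assms(4))
  also have "\<dots> = c" using assms(1-3) by (subst m_assoc[symmetric]) simp_all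
  finally show ?thesis .
qed

lemma (in group) commutator_closed: "a \<in> carrier G \<Longrightarrow> b \<in> carrier G \<Longrightarrow> commutator G a b \<in> carrier G"
  by (simp add: commutator_def)

lemma (in group) commutator_swap:
  assumes "a \<in> carrier G" "b \<in> carrier G"
  shows "b \<otimes> a \<otimes> commutator G a b = a \<otimes> b"
  using assms by (simp add: commutator_def m_assoc[symmetric]) (simp add: m_assoc)



text \<open>Diagonal pairs index the generators and pairs \<open>a < b\<close> their commutators, so
  one exponent function describes a whole normal form.\<close>

definition model_index :: "nat \<Rightarrow> (nat \<times> nat) set" where
  "model_index d = (SIGMA a:{1..d}. {a..d})"

locale class_2_group = group G for G (structure) +
  assumes class_2: "triple_commutators G \<subseteq> {\<one>}"
begin

lemma commutator_central:
  assumes "a \<in> carrier G" "b \<in> carrier G" "c \<in> carrier G"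
  shows "c \<otimes> commutator G a b = commutator G a b \<otimes> c"
proof -
  have "commutator G (commutator G a b) c = \<one>"
    using class_2 assms unfolding triple_commutators_def by blast
  then show ?thesis using commutator_swap[of "commutator G a b" c] assms by (simp add: commutator_closed)
qed

lemma pow_central:
  fixes n :: nat
  assumes "k \<in> carrier G" "c \<in> carrier G" "c \<otimes> k = k \<otimes> c"
  shows "c \<otimes> k [^] n = k [^] n \<otimes> c"
proof (induction n)
  case (Suc n)
  have "c \<otimes> k [^] Suc n = (c \<otimes> k [^] n) \<otimes> k" using assms by (simp add: m_assoc)
  also have "\<dots> = k [^] n \<otimes> (c \<otimes> k)" using assms by (simp add: Suc.IH m_assoc)
  also have "\<dots> = k [^] Suc n \<otimes> c" using assms by (simp add: m_assoc)
  finally show ?case .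
qed (use assms in simp)

text \<open>Each of the \<open>n\<close> factors \<open>b\<close> that \<open>a\<close> passes
  leaves one commutator, and these are central.\<close>

lemma swap_pow:
  fixes n :: nat
  assumes a: "a \<in> carrier G" and b: "b \<in> carrier G"
  shows "a \<otimes> b [^] n = b [^] n \<otimes> commutator G a b [^] n \<otimes> a"
proof (induction n)
  case (Suc n)
  let ?k = "commutator G a b"
  have k: "?k \<in> carrier G" and kc: "\<And>c. c \<in> carrier G \<Longrightarrow> c \<otimes> ?k = ?k \<otimes> c"
    using a b by (simp_all add: commutator_closed commutator_central)
  have ab: "a \<otimes> b = b \<otimes> ?k \<otimes> a"
    using commutator_swap[OF a b] kc[OF a] a b k by (simp add: m_assoc)
  have "a \<otimes> b [^] Suc n = b [^] n \<otimes> ?k [^] n \<otimes> (a \<otimes> b)"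
    using a b k by (simp add: m_assoc[symmetric] Suc.IH)
  also have "\<dots> = b [^] n \<otimes> (?k [^] n \<otimes> b) \<otimes> ?k \<otimes> a" using a b k by (simp add: ab m_assoc)
  also have "?k [^] n \<otimes> b = b \<otimes> ?k [^] n" using pow_central[OF k b kc[OF b]] by simp
  finally show ?case using a b k by (simp add: m_assoc)
qed (use assms in simp)

end

text \<open>The powers of the generators appear in descending order: then the cross terms of \<open>model_group\<close>
  vanish in the product, and no correction to the exponents is needed.\<close>

context group begin

primrec commutator_block :: "(nat \<Rightarrow> 'a) \<Rightarrow> (nat \<times> nat \<Rightarrow> nat) \<Rightarrow> nat \<Rightarrow> nat \<Rightarrow> 'a" where
  "commutator_block y f b 0 = \<one>"
| "commutator_block y f b (Suc n) = commutator G (y (Suc n)) (y b) [^] f (Suc n, b) \<otimes> commutator_block y f b n"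

primrec normal_form :: "(nat \<Rightarrow> 'a) \<Rightarrow> (nat \<times> nat \<Rightarrow> nat) \<Rightarrow> nat \<Rightarrow> 'a" where
  "normal_form y f 0 = \<one>"
| "normal_form y f (Suc n) = y (Suc n) [^] f (Suc n, Suc n) \<otimes> commutator_block y f (Suc n) n \<otimes> normal_form y f n"

lemma commutator_block_closed:
  "y \<in> {1..d} \<rightarrow> carrier G \<Longrightarrow> n \<le> d \<Longrightarrow> b \<in> {1..d} \<Longrightarrow> commutator_block y f b n \<in> carrier G"
  by (induction n) (auto simp: commutator_closed Pi_iff)

lemma normal_form_closed: "y \<in> {1..d} \<rightarrow> carrier G \<Longrightarrow> n \<le> d \<Longrightarrow> normal_form y f n \<in> carrier G"
  by (induction n) (auto simp: commutator_block_closed Pi_iff)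

lemma commutator_block_cong:
  "(\<And>a. 1 \<le> a \<Longrightarrow> a \<le> n \<Longrightarrow> f (a, b) = g (a, b)) \<Longrightarrow> commutator_block y f b n = commutator_block y g b n"
  by (induction n) auto

lemma normal_form_cong:
  "(\<And>i. i \<in> model_index n \<Longrightarrow> f i = g i) \<Longrightarrow> normal_form y f n = normal_form y g n"
proof (induction n)
  case (Suc n)
  have "commutator_block y f (Suc n) n = commutator_block y g (Suc n) n"
    by (rule commutator_block_cong) (use Suc.prems in \<open>auto simp: model_index_def\<close>)
  moreover have "normal_form y f n = normal_form y g n"
    by (rule Suc.IH, rule Suc.prems) (auto simp: model_index_def)
  ultimately show ?case using Suc.prems[of "(Suc n, Suc n)"] by (simp add: model_index_def)
qed simp

lemma normal_form_zero: "y \<in> {1..n} \<rightarrow> carrier G \<Longrightarrow> normal_form y (\<lambda>i. 0) n = \<one>"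
proof -
  have "commutator_block y (\<lambda>i. 0) b n = \<one>" for b n by (induction n) auto
  then show ?thesis by (induction n) auto
qed

lemma normal_form_mod:
  assumes exp: "\<And>x. x \<in> carrier G \<Longrightarrow> x [^] p = \<one>" and y: "y \<in> {1..d} \<rightarrow> carrier G" and n: "n \<le> d"
  shows "normal_form y (\<lambda>i. f i mod p) n = normal_form y f n"
proof -
  have pow: "x [^] (m mod p) = x [^] m" if "x \<in> carrier G" for x m
  proof -
    have "x [^] m = x [^] (p * (m div p) + m mod p)" by simp
    also have "\<dots> = (x [^] p) [^] (m div p) \<otimes> x [^] (m mod p)" using that by (simp only: nat_pow_mult nat_pow_pow nat_pow_closed)
    finally show ?thesis using exp[OF that] that by simp
  qed
  have "commutator_block y (\<lambda>i. f i mod p) b n = commutator_block y f b n" if "n \<le> d" "b \<in> {1..d}" for b n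
    using that y by (induction n) (auto simp: pow commutator_closed Pi_iff)
  then show ?thesis using n y by (induction n) (auto simp: pow Pi_iff)
qed

end

section \<open>Left multiplication of a normal form by a generator\<close>

context class_2_group begin

text \<open>Commutators are central, so further copies of one factor can be moved to the front of
  the block.\<close>

lemma commutator_block_add:
  assumes y: "y \<in> {1..d} \<rightarrow> carrier G" and "n \<le> d" "b \<in> {1..d}" "1 \<le> c" "c \<le> n"
  shows "commutator_block y (f((c, b) := f (c, b) + m)) b n = commutator G (y c) (y b) [^] m \<otimes> commutator_block y f b n"
  using assms(2,5)
proof (induction n)
  case (Suc n)
  have yb: "y b \<in> carrier G" and yc: "y c \<in> carrier G" and yn: "y (Suc n) \<in> carrier G"
    using y Suc.prems assms by auto
  let ?f = "f((c, b) := f (c, b) + m)"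
  have B: "commutator_block y f b n \<in> carrier G" using commutator_block_closed[OF y] Suc.prems assms by simp
  have k: "commutator G (y c) (y b) \<in> carrier G" and kn: "commutator G (y (Suc n)) (y b) \<in> carrier G"
    using yb yc yn by (simp_all add: commutator_closed)
  show ?case
  proof (cases "c = Suc n")
    case True
    have "commutator_block y ?f b n = commutator_block y f b n"
      by (rule commutator_block_cong) (use True in auto)
    then have "commutator_block y ?f b (Suc n)
      = commutator G (y c) (y b) [^] (m + f (c, b)) \<otimes> commutator_block y f b n"
      unfolding commutator_block.simps using True by (simp only: fun_upd_same add.commute)
    also have "\<dots> = commutator G (y c) (y b) [^] m \<otimes> (commutator G (y c) (y b) [^] f (c, b) \<otimes> commutator_block y f b n)"
      using k B by (simp only: nat_pow_mult[symmetric] m_assoc nat_pow_closed)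
    finally show ?thesis using True by (simp only: commutator_block.simps)
  next
    case False
    then have IH: "commutator_block y ?f b n = commutator G (y c) (y b) [^] m \<otimes> commutator_block y f b n"
      by (intro Suc.IH) (use Suc.prems in auto)
    have comm: "commutator G (y (Suc n)) (y b) [^] f (Suc n, b) \<otimes> commutator G (y c) (y b) [^] m
      = commutator G (y c) (y b) [^] m \<otimes> commutator G (y (Suc n)) (y b) [^] f (Suc n, b)"
      by (rule pow_central[OF k]) (use kn yb yc in \<open>auto simp: commutator_central\<close>)
    have "?f (Suc n, b) = f (Suc n, b)" using False by simp
    then have "commutator_block y ?f b (Suc n)
      = commutator G (y (Suc n)) (y b) [^] f (Suc n, b) \<otimes> (commutator G (y c) (y b) [^] m \<otimes> commutator_block y f b n)"
      by (simp only: commutator_block.simps IH)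
    also have "\<dots> = (commutator G (y (Suc n)) (y b) [^] f (Suc n, b) \<otimes> commutator G (y c) (y b) [^] m) \<otimes> commutator_block y f b n"
      using k kn B by (simp add: m_assoc)
    also have "\<dots> = (commutator G (y c) (y b) [^] m \<otimes> commutator G (y (Suc n)) (y b) [^] f (Suc n, b)) \<otimes> commutator_block y f b n"
      by (simp only: comm)
    also have "\<dots> = commutator G (y c) (y b) [^] m \<otimes> commutator_block y f b (Suc n)"
      using k kn B by (simp add: m_assoc)
    finally show ?thesis .
  qed
qed (use assms in simp)

text \<open>The exponents of \<open>y c\<close> times a normal form: on its way to the right,
  \<open>y c\<close> leaves one commutator with \<open>y b\<close> for each factor
  \<open>y b\<close> with \<open>b > c\<close> that it passes.\<close>

definition push :: "nat \<Rightarrow> (nat \<times> nat \<Rightarrow> nat) \<Rightarrow> nat \<times> nat \<Rightarrow> nat" where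
  "push c f i = f i + (if i = (c, c) then 1 else 0) + (if fst i = c \<and> c < snd i then f (snd i, snd i) else 0)"

lemma commutator_block_commute:
  assumes y: "y \<in> {1..d} \<rightarrow> carrier G" and "n \<le> d" "b \<in> {1..d}" and c: "c \<in> carrier G"
  shows "c \<otimes> commutator_block y f b n = commutator_block y f b n \<otimes> c"
  using assms(2)
proof (induction n)
  case (Suc n)
  have yb: "y b \<in> carrier G" and yn: "y (Suc n) \<in> carrier G" using y Suc.prems assms by auto
  let ?k = "commutator G (y (Suc n)) (y b) [^] f (Suc n, b)"
  have B: "commutator_block y f b n \<in> carrier G" using commutator_block_closed[OF y] Suc.prems assms by simp
  have k: "?k \<in> carrier G" using yb yn by (simp add: commutator_closed)
  have "c \<otimes> ?k = ?k \<otimes> c" by (rule pow_central) (use yb yn c in \<open>auto simp: commutator_closed commutator_central\<close>)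
  then have "c \<otimes> (?k \<otimes> commutator_block y f b n) = ?k \<otimes> (c \<otimes> commutator_block y f b n)"
    using c k B by (simp add: m_assoc[symmetric])
  then show ?case using Suc c k B by (simp add: m_assoc)
qed (use c in simp)

text \<open>The leading power belongs to the largest index. If this is \<open>c\<close>, its
  exponent grows by one. Otherwise \<open>swap_pow\<close> moves \<open>y c\<close> past it, the
  commutators created join the block of \<open>Suc n\<close>, and the induction hypothesis treats
  the rest.\<close>

lemma normal_form_push:
  assumes y: "y \<in> {1..d} \<rightarrow> carrier G" and "n \<le> d" "1 \<le> c" "c \<le> n"
  shows "y c \<otimes> normal_form y f n = normal_form y (push c f) n"
  using assms(2,4)
proof (induction n)
  case (Suc n)
  have yc: "y c \<in> carrier G" and yn: "y (Suc n) \<in> carrier G" using y Suc.prems assms by auto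
  let ?B = "commutator_block y f (Suc n) n" and ?N = "normal_form y f n" and ?m = "f (Suc n, Suc n)"
  have B: "?B \<in> carrier G" and N: "?N \<in> carrier G"
    using commutator_block_closed[OF y] normal_form_closed[OF y] Suc.prems by simp_all
  show ?case
  proof (cases "c = Suc n")
    case True
    have "normal_form y (push c f) n = ?N"
      by (rule normal_form_cong) (use True in \<open>auto simp: model_index_def push_def\<close>)
    moreover have "commutator_block y (push c f) (Suc n) n = ?B"
      by (rule commutator_block_cong) (use True in \<open>auto simp: push_def\<close>)
    moreover have "push c f (Suc n, Suc n) = Suc ?m" using True by (simp add: push_def)
    ultimately have "normal_form y (push c f) (Suc n) = y c [^] Suc ?m \<otimes> ?B \<otimes> ?N"
      unfolding normal_form.simps by (simp only: True)
    also have "\<dots> = y c \<otimes> (y c [^] ?m \<otimes> ?B \<otimes> ?N)" using yc B N by (simp only: nat_pow_Suc2 m_assoc nat_pow_closed m_closed)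
    finally show ?thesis using True by simp
  next
    case False
    then have c: "c \<le> n" using Suc.prems by simp
    let ?k = "commutator G (y c) (y (Suc n))"
    have k: "?k \<in> carrier G" using yc yn by (simp add: commutator_closed)
    \<comment> \<open>Within this block \<open>push\<close> changes only the entry at
      \<open>(c, Suc n)\<close>.\<close>
    have "commutator_block y (push c f) (Suc n) n = commutator_block y (f((c, Suc n) := f (c, Suc n) + ?m)) (Suc n) n"
      by (rule commutator_block_cong) (use c in \<open>auto simp: push_def\<close>)
    also have "\<dots> = ?k [^] ?m \<otimes> ?B"
      by (rule commutator_block_add[OF y]) (use Suc.prems assms(3) c in auto)
    moreover have "push c f (Suc n, Suc n) = ?m" using False by (simp add: push_def)
    moreover have "normal_form y (push c f) n = y c \<otimes> ?N" using Suc.IH c Suc.prems(1) by simp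
    ultimately have "normal_form y (push c f) (Suc n) = y (Suc n) [^] ?m \<otimes> (?k [^] ?m \<otimes> ?B) \<otimes> (y c \<otimes> ?N)"
      unfolding normal_form.simps by simp
    also have "\<dots> = y (Suc n) [^] ?m \<otimes> ?k [^] ?m \<otimes> (?B \<otimes> y c) \<otimes> ?N"
      using yc yn B N k by (simp add: m_assoc)
    also have "?B \<otimes> y c = y c \<otimes> ?B"
      using commutator_block_commute[OF y _ _ yc, of n "Suc n"] Suc.prems by simp
    also have "y (Suc n) [^] ?m \<otimes> ?k [^] ?m \<otimes> (y c \<otimes> ?B) \<otimes> ?N = (y (Suc n) [^] ?m \<otimes> ?k [^] ?m \<otimes> y c) \<otimes> ?B \<otimes> ?N"
      using yc yn B N k by (simp add: m_assoc)
    also have "\<dots> = y c \<otimes> normal_form y f (Suc n)"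
      using yc yn B N by (simp add: swap_pow[OF yc yn, symmetric] m_assoc)
    finally show ?thesis ..
  qed
qed (use assms in simp)

end

section \<open>The model group\<close>

text \<open>The bilinear 2-cocycle of a central extension; it reads only diagonal entries and
  vanishes at diagonal positions.\<close>

definition cross :: "(nat \<times> nat \<Rightarrow> int) \<Rightarrow> (nat \<times> nat \<Rightarrow> int) \<Rightarrow> nat \<times> nat \<Rightarrow> int" where
  "cross f g i = (if fst i < snd i then f (fst i, fst i) * g (snd i, snd i) else 0)"

text \<open>The entry at \<open>(a, a)\<close> is the exponent of the \<open>a\<close>-th generator, the entry at \<open>(a, b)\<close> with \<open>a < b\<close>
  the exponent of the commutator of the \<open>a\<close>-th and the \<open>b\<close>-th generator.\<close>

definition model_group :: "nat \<Rightarrow> nat \<Rightarrow> (nat \<times> nat \<Rightarrow> int) monoid" where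
  "model_group p d =
     \<lparr>carrier = model_index d \<rightarrow>\<^sub>E {0..<int p},
      monoid.mult = (\<lambda>f g. \<lambda>i\<in>model_index d. (f i + g i + cross f g i) mod int p),
      one = (\<lambda>i\<in>model_index d. 0)\<rparr>"

definition model_gen :: "nat \<Rightarrow> nat \<Rightarrow> nat \<times> nat \<Rightarrow> int" where
  "model_gen d a = (\<lambda>i\<in>model_index d. if i = (a, a) then 1 else 0)"

lemma finite_model_index: "finite (model_index d)"
  by (simp add: model_index_def)

lemma card_model_index: "card (model_index d) = \<Sum>{..d}"
proof -
  have "card (model_index d) = (\<Sum>a\<in>{1..d}. Suc d - a)" by (simp add: model_index_def)
  also have "\<dots> = (\<Sum>a\<in>{1..d}. a)"
    by (rule sum.reindex_bij_witness[of _ "\<lambda>a. Suc d - a" "\<lambda>a. Suc d - a"]) auto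
  also have "\<dots> = \<Sum>{..d}"
    by (rule sum.mono_neutral_left) auto
  finally show ?thesis .
qed

lemma model_index_diag: "(a, b) \<in> model_index d \<Longrightarrow> (a, a) \<in> model_index d \<and> (b, b) \<in> model_index d"
  by (auto simp: model_index_def)

locale odd_prime =
  fixes p :: nat
  assumes prime_p: "prime p" and odd_p: "odd p"
begin

lemma p_pos: "0 < int p" and p_gt_1: "1 < int p"
  using prime_p prime_gt_1_nat[of p] by auto

abbreviation "H \<equiv> model_group p"

lemma restrict_mod_closed: "(\<lambda>i\<in>model_index d. f i mod int p) \<in> carrier (H d)"
  using p_pos by (simp add: model_group_def)

lemma model_mult: "i \<in> model_index d \<Longrightarrow> (f \<otimes>\<^bsub>H d\<^esub> g) i = (f i + g i + cross f g i) mod int p"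
  by (simp add: model_group_def)

lemma model_mult_closed: "f \<otimes>\<^bsub>H d\<^esub> g \<in> carrier (H d)"
  using p_pos by (simp add: model_group_def)

lemma model_one: "i \<in> model_index d \<Longrightarrow> \<one>\<^bsub>H d\<^esub> i = 0"
  by (simp add: model_group_def)

lemma model_eqI:
  assumes "f \<in> carrier (H d)" "g \<in> carrier (H d)"
    and "\<And>i. i \<in> model_index d \<Longrightarrow> [f i = g i] (mod int p)"
  shows "f = g"
proof (rule PiE_ext)
  show fg: "f \<in> model_index d \<rightarrow>\<^sub>E {0..<int p}" "g \<in> model_index d \<rightarrow>\<^sub>E {0..<int p}"
    using assms by (auto simp: model_group_def)
  fix i assume i: "i \<in> model_index d"
  then have "f i \<in> {0..<int p}" "g i \<in> {0..<int p}" using fg by auto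
  then show "f i = g i" using assms(3)[OF i] by (simp add: cong_def)
qed

lemma cross_cong:
  assumes "i \<in> model_index d" "\<And>a. (a, a) \<in> model_index d \<Longrightarrow> [f (a, a) = f' (a, a)] (mod int p)"
    "\<And>a. (a, a) \<in> model_index d \<Longrightarrow> [g (a, a) = g' (a, a)] (mod int p)"
  shows "[cross f g i = cross f' g' i] (mod int p)"
  using assms model_index_diag[of "fst i" "snd i"] by (auto simp: cross_def intro: cong_mult)

lemma model_mult_cong: "i \<in> model_index d \<Longrightarrow> [(f \<otimes>\<^bsub>H d\<^esub> g) i = f i + g i + cross f g i] (mod int p)"
  by (simp add: model_mult cong_def)

lemma model_mult_diag: "(a, a) \<in> model_index d \<Longrightarrow> [(f \<otimes>\<^bsub>H d\<^esub> g) (a, a) = f (a, a) + g (a, a)] (mod int p)"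
  using model_mult_cong[of "(a, a)" d f g] by (simp add: cross_def)

text \<open>The term \<open>cross f f\<close> cancels the cross term between \<open>- f\<close> and
  \<open>f\<close>.\<close>

definition model_inv :: "nat \<Rightarrow> (nat \<times> nat \<Rightarrow> int) \<Rightarrow> nat \<times> nat \<Rightarrow> int" where
  "model_inv d f = (\<lambda>i\<in>model_index d. (cross f f i - f i) mod int p)"

lemma model_inv_mult:
  assumes f: "f \<in> carrier (H d)"
  shows "model_inv d f \<otimes>\<^bsub>H d\<^esub> f = \<one>\<^bsub>H d\<^esub>"
proof (rule model_eqI[OF model_mult_closed])
  fix i assume i: "i \<in> model_index d"
  have "[cross (model_inv d f) f i = cross (\<lambda>i. - f i) f i] (mod int p)"
    by (rule cross_cong[OF i]) (simp_all add: model_inv_def cross_def cong_def)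
  then have "[model_inv d f i + f i + cross (model_inv d f) f i
     = (cross f f i - f i) + f i + cross (\<lambda>i. - f i) f i] (mod int p)"
    by (intro cong_add) (simp_all add: model_inv_def cong_def i)
  also have "(cross f f i - f i) + f i + cross (\<lambda>i. - f i) f i = 0" by (simp add: cross_def)
  finally show "[(model_inv d f \<otimes>\<^bsub>H d\<^esub> f) i = \<one>\<^bsub>H d\<^esub> i] (mod int p)"
    using model_mult_cong[OF i] model_one[OF i] cong_trans by metis
qed (use p_pos in \<open>simp add: model_group_def\<close>)

lemma model_is_group: "group (H d)"
proof (rule groupI)
  fix f g h assume "f \<in> carrier (H d)" "g \<in> carrier (H d)" "h \<in> carrier (H d)"
  show "f \<otimes>\<^bsub>H d\<^esub> g \<otimes>\<^bsub>H d\<^esub> h = f \<otimes>\<^bsub>H d\<^esub> (g \<otimes>\<^bsub>H d\<^esub> h)"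
  proof (rule model_eqI[OF model_mult_closed model_mult_closed])
    fix i assume i: "i \<in> model_index d"
    \<comment> \<open>Both bracketings are congruent to one expression: \<open>cross\<close> is
      bilinear and reads only diagonal entries, which multiplication adds modulo
      \<open>p\<close>.\<close>
    have "[(f \<otimes>\<^bsub>H d\<^esub> g) i + h i + cross (f \<otimes>\<^bsub>H d\<^esub> g) h i
      = (f i + g i + cross f g i) + h i + cross (\<lambda>i. f i + g i) h i] (mod int p)"
      by (intro cong_add cross_cong[OF i] model_mult_cong model_mult_diag i cong_refl)
    also have "(f i + g i + cross f g i) + h i + cross (\<lambda>i. f i + g i) h i
      = f i + (g i + h i + cross g h i) + cross f (\<lambda>i. g i + h i) i"
      by (simp add: cross_def ring_distribs)
    finally have 1: "[(f \<otimes>\<^bsub>H d\<^esub> g) i + h i + cross (f \<otimes>\<^bsub>H d\<^esub> g) h i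
      = f i + (g i + h i + cross g h i) + cross f (\<lambda>i. g i + h i) i] (mod int p)" .
    have 2: "[f i + (g \<otimes>\<^bsub>H d\<^esub> h) i + cross f (g \<otimes>\<^bsub>H d\<^esub> h) i
      = f i + (g i + h i + cross g h i) + cross f (\<lambda>i. g i + h i) i] (mod int p)"
      by (intro cong_add cross_cong[OF i] model_mult_cong model_mult_diag i cong_refl)
    show "[(f \<otimes>\<^bsub>H d\<^esub> g \<otimes>\<^bsub>H d\<^esub> h) i = (f \<otimes>\<^bsub>H d\<^esub> (g \<otimes>\<^bsub>H d\<^esub> h)) i] (mod int p)"
      using cong_trans[OF model_mult_cong[OF i] cong_trans[OF 1 cong_sym[OF 2]]] cong_sym[OF model_mult_cong[OF i]]
      by (rule cong_trans)
  qed
next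
  fix f assume f: "f \<in> carrier (H d)"
  show "\<one>\<^bsub>H d\<^esub> \<otimes>\<^bsub>H d\<^esub> f = f"
  proof (rule model_eqI[OF model_mult_closed f])
    fix i assume i: "i \<in> model_index d"
    have "cross \<one>\<^bsub>H d\<^esub> f i = 0"
      using i model_index_diag[of "fst i" "snd i"] by (auto simp: cross_def model_one)
    then show "[(\<one>\<^bsub>H d\<^esub> \<otimes>\<^bsub>H d\<^esub> f) i = f i] (mod int p)"
      using model_mult_cong[OF i, of "\<one>\<^bsub>H d\<^esub>" f] model_one[OF i] by simp
  qed
  show "\<exists>g\<in>carrier (H d). g \<otimes>\<^bsub>H d\<^esub> f = \<one>\<^bsub>H d\<^esub>"
    using model_inv_mult[OF f] restrict_mod_closed[of "\<lambda>i. cross f f i - f i" d]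
    unfolding model_inv_def by blast
qed (use p_pos in \<open>auto simp: model_mult_closed\<close>, simp add: model_group_def)

lemma model_inv_eq:
  assumes "f \<in> carrier (H d)" shows "inv\<^bsub>H d\<^esub> f = model_inv d f"
  by (rule group.inv_equality[OF model_is_group model_inv_mult[OF assms] assms])
    (simp add: model_inv_def restrict_mod_closed)

section \<open>Order, exponent and class of the model\<close>

lemma order_model: "order (H d) = p ^ \<Sum>{..d}"
  by (simp add: order_def model_group_def card_PiE finite_model_index card_model_index)

text \<open>The diagonal of the \<open>n\<close>-th power is \<open>n\<close> times that of
  \<open>f\<close>, so the next factor adds \<open>n\<close> times \<open>cross f f\<close>; these
  multiples sum to \<open>n choose 2\<close>.\<close>

lemma model_nat_pow:
  assumes "f \<in> carrier (H d)" "i \<in> model_index d"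
  shows "[(f [^]\<^bsub>H d\<^esub> n) i = int n * f i + int (n choose 2) * cross f f i] (mod int p)"
  using assms(2)
proof (induction n arbitrary: i)
  case 0
  then show ?case by (simp add: model_one numeral_2_eq_2)
next
  case (Suc n)
  have "[cross (f [^]\<^bsub>H d\<^esub> n) f i = cross (\<lambda>i. int n * f i) f i] (mod int p)"
  proof (rule cross_cong[OF Suc.prems])
    show "[(f [^]\<^bsub>H d\<^esub> n) (a, a) = int n * f (a, a)] (mod int p)" if "(a, a) \<in> model_index d" for a
      using Suc.IH[OF that] by (simp add: cross_def)
  qed simp
  then have "[(f [^]\<^bsub>H d\<^esub> n) i + f i + cross (f [^]\<^bsub>H d\<^esub> n) f i
    = int n * f i + int (n choose 2) * cross f f i + f i + cross (\<lambda>i. int n * f i) f i] (mod int p)"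
    by (intro cong_add Suc.IH Suc.prems) auto
  also have "int n * f i + int (n choose 2) * cross f f i + f i + cross (\<lambda>i. int n * f i) f i
    = int (Suc n) * f i + int (Suc n choose 2) * cross f f i"
    by (simp add: cross_def numeral_2_eq_2 algebra_simps)
  finally have "[(f [^]\<^bsub>H d\<^esub> n) i + f i + cross (f [^]\<^bsub>H d\<^esub> n) f i
    = int (Suc n) * f i + int (Suc n choose 2) * cross f f i] (mod int p)" .
  then show ?case using cong_trans[OF model_mult_cong[OF Suc.prems]] by simp
qed

lemma model_exponent:
  assumes "f \<in> carrier (H d)" shows "f [^]\<^bsub>H d\<^esub> p = \<one>\<^bsub>H d\<^esub>"
proof (rule model_eqI)
  interpret group "H d" by (rule model_is_group)
  show "f [^]\<^bsub>H d\<^esub> p \<in> carrier (H d)" "\<one>\<^bsub>H d\<^esub> \<in> carrier (H d)" using assms by auto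
  fix i assume i: "i \<in> model_index d"
  \<comment> \<open>Oddness enters here: the prime \<open>p\<close> divides
    \<open>p choose 2\<close> only if \<open>p > 2\<close>.\<close>
  have "2 < p" using prime_p odd_p prime_ge_2_nat[of p] by (cases "p = 2") auto
  then have "int p dvd int (p choose 2)" using dvd_choose_prime[of 2 p] prime_p by simp
  then have "[int p * f i + int (p choose 2) * cross f f i = 0] (mod int p)" by (simp add: cong_0_iff)
  then show "[(f [^]\<^bsub>H d\<^esub> p) i = \<one>\<^bsub>H d\<^esub> i] (mod int p)"
    using cong_trans[OF model_nat_pow[OF assms i]] model_one[OF i] by simp
qed

definition model_comm :: "nat \<Rightarrow> (nat \<times> nat \<Rightarrow> int) \<Rightarrow> (nat \<times> nat \<Rightarrow> int) \<Rightarrow> nat \<times> nat \<Rightarrow> int" where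
  "model_comm d f g = (\<lambda>i\<in>model_index d. (cross f g i - cross g f i) mod int p)"

lemma model_commutator:
  assumes f: "f \<in> carrier (H d)" and g: "g \<in> carrier (H d)"
  shows "commutator (H d) f g = model_comm d f g"
proof (rule group.commutator_eqI[OF model_is_group f g])
  show c: "model_comm d f g \<in> carrier (H d)" by (simp add: model_comm_def restrict_mod_closed)
  show "g \<otimes>\<^bsub>H d\<^esub> f \<otimes>\<^bsub>H d\<^esub> model_comm d f g = f \<otimes>\<^bsub>H d\<^esub> g"
  proof (rule model_eqI[OF model_mult_closed model_mult_closed])
    fix i assume i: "i \<in> model_index d"
    have "[cross (g \<otimes>\<^bsub>H d\<^esub> f) (model_comm d f g) i = cross (g \<otimes>\<^bsub>H d\<^esub> f) (\<lambda>i. 0) i] (mod int p)"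
      by (rule cross_cong[OF i]) (simp_all add: model_comm_def cross_def)
    then have "[(g \<otimes>\<^bsub>H d\<^esub> f) i + model_comm d f g i + cross (g \<otimes>\<^bsub>H d\<^esub> f) (model_comm d f g) i
      = (g i + f i + cross g f i) + (cross f g i - cross g f i) + cross (g \<otimes>\<^bsub>H d\<^esub> f) (\<lambda>i. 0) i] (mod int p)"
      by (intro cong_add model_mult_cong[OF i]) (simp_all add: model_comm_def i cong_def)
    also have "(g i + f i + cross g f i) + (cross f g i - cross g f i) + cross (g \<otimes>\<^bsub>H d\<^esub> f) (\<lambda>i. 0) i
      = f i + g i + cross f g i" by (simp add: cross_def)
    finally show "[(g \<otimes>\<^bsub>H d\<^esub> f \<otimes>\<^bsub>H d\<^esub> model_comm d f g) i = (f \<otimes>\<^bsub>H d\<^esub> g) i] (mod int p)"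
      using cong_trans[OF model_mult_cong[OF i]] cong_trans[OF _ cong_sym[OF model_mult_cong[OF i]]] by blast
  qed
qed

text \<open>A commutator has zero diagonal, so every cross term with it vanishes.\<close>

lemma model_class_2: "triple_commutators (H d) \<subseteq> {\<one>\<^bsub>H d\<^esub>}"
proof
  fix t assume "t \<in> triple_commutators (H d)"
  then obtain a b c where t: "t = commutator (H d) (commutator (H d) a b) c"
    and abc: "a \<in> carrier (H d)" "b \<in> carrier (H d)" "c \<in> carrier (H d)"
    by (auto simp: triple_commutators_def)
  have m: "model_comm d a b \<in> carrier (H d)" by (simp add: model_comm_def restrict_mod_closed)
  have "cross (model_comm d a b) c i = 0" "cross c (model_comm d a b) i = 0" if "i \<in> model_index d" for i
    using that model_index_diag[of "fst i" "snd i"] by (auto simp: cross_def model_comm_def)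
  then have "model_comm d (model_comm d a b) c = \<one>\<^bsub>H d\<^esub>"
    by (auto simp: model_comm_def[of d "model_comm d a b"] model_group_def)
  then show "t \<in> {\<one>\<^bsub>H d\<^esub>}" using t abc m by (simp add: model_commutator)
qed

lemma model_p_group_class_le_2: "p_group_class_le_2 p (H d)"
  using model_is_group order_model model_class_2 by (auto simp: p_group_class_le_2_def)

section \<open>Generation of the model\<close>

lemma model_gen_closed: "model_gen d a \<in> carrier (H d)"
  using p_gt_1 by (auto simp: model_gen_def model_group_def)

definition model_eval :: "nat \<Rightarrow> (nat \<times> bool) list \<Rightarrow> nat \<times> nat \<Rightarrow> int" where
  "model_eval d = free_eval (H d) (model_gen d)"

lemma model_eval_hom: "group_hom (free_group {1..d}) (H d) (model_eval d)"
  unfolding model_eval_def using group.free_eval_hom[OF model_is_group, of "model_gen d" "{1..d}" d]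
  by (simp add: group_hom_def group_hom_axioms_def model_is_group group_free_group model_gen_closed)

text \<open>Elements with at most one nonzero entry are powers of generators or of their
  commutators. Any element is built from these by splitting off entries on the left, the diagonal
  ones first and from the largest index down, so that no cross term arises.\<close>

lemma model_eval_surj: "model_eval d ` carrier (free_group {1..d}) = carrier (H d)"
proof -
  interpret e: group_hom "free_group {1..d}" "H d" "model_eval d" by (rule model_eval_hom)
  let ?S = "model_eval d ` carrier (free_group {1..d})"
  interpret S: subgroup ?S "H d" by (rule e.img_is_subgroup)
  have pow: "f [^]\<^bsub>H d\<^esub> n \<in> ?S" if "f \<in> ?S" for f and n :: nat
  proof (induction n)
    case 0
    show ?case using S.one_closed by simp
  next
    case (Suc n)
    show ?case using S.m_closed[OF Suc.IH that] by simp
  qed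
  have gen: "model_gen d a \<in> ?S" if "a \<in> {1..d}" for a
    using e.H.free_eval_gen[of "model_gen d" "{1..d}" a] that free_gen_closed[OF that] model_gen_closed
    unfolding model_eval_def by (metis Pi_I image_eqI)
  define T where "T i n = (\<lambda>j\<in>model_index d. if j = i then n else 0)" for i :: "nat \<times> nat" and n :: int
  have T_closed: "T i n \<in> carrier (H d)" if "n \<in> {0..<int p}" for i n
    using that p_pos by (auto simp: T_def model_group_def)
  have T: "T i n \<in> ?S" if i: "i \<in> model_index d" and n: "n \<in> {0..<int p}" for i n
  proof -
    have one: "T i 1 \<in> ?S \<and> (\<forall>j\<in>model_index d. cross (T i 1) (T i 1) j = 0)"
    proof (cases "fst i = snd i")
      case True
      then have "T i 1 = model_gen d (fst i)" by (auto simp: T_def model_gen_def fun_eq_iff prod_eq_iff)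
      then show ?thesis using gen[of "fst i"] i model_index_diag by (auto simp: model_index_def cross_def model_gen_def)
    next
      case False
      then have lt: "fst i < snd i" "fst i \<in> {1..d}" "snd i \<in> {1..d}" using i by (auto simp: model_index_def)
      have "T i 1 = model_comm d (model_gen d (fst i)) (model_gen d (snd i))"
      proof
        fix j
        show "T i 1 j = model_comm d (model_gen d (fst i)) (model_gen d (snd i)) j"
          using lt p_gt_1 model_index_diag[of "fst j" "snd j"]
          by (cases "j \<in> model_index d") (auto simp: T_def model_comm_def model_gen_def cross_def prod_eq_iff)
      qed
      moreover have "\<dots> \<in> ?S" using gen[OF lt(2)] gen[OF lt(3)]
        unfolding model_commutator[OF model_gen_closed model_gen_closed, symmetric] commutator_def by blast
      moreover have "cross (T i 1) (T i 1) j = 0" if "j \<in> model_index d" for j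
        using False that model_index_diag[of "fst j" "snd j"] by (auto simp: cross_def T_def)
      ultimately show ?thesis by simp
    qed
    have "T i 1 [^]\<^bsub>H d\<^esub> nat n = T i n"
    proof (rule model_eqI)
      show "T i 1 [^]\<^bsub>H d\<^esub> nat n \<in> carrier (H d)" "T i n \<in> carrier (H d)"
        using T_closed n p_gt_1 by auto
      show "[(T i 1 [^]\<^bsub>H d\<^esub> nat n) j = T i n j] (mod int p)" if j: "j \<in> model_index d" for j
        using model_nat_pow[of "T i 1" d j "nat n"] one T_closed[of 1 i] p_gt_1 j n by (auto simp: T_def)
    qed
    then show ?thesis using pow one by metis
  qed
  \<comment> \<open>Cross terms could arise only if \<open>i\<close> is a diagonal pair
    \<open>(a, a)\<close>; they would involve diagonal entries beyond \<open>a\<close>, which are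
    assumed to vanish.\<close>
  have split: "T i (f i) \<otimes>\<^bsub>H d\<^esub> (\<lambda>j\<in>model_index d. if j = i then 0 else f j) = f"
    if f: "f \<in> carrier (H d)" and i: "i \<in> model_index d"
      and 0: "\<And>a b. i = (a, a) \<Longrightarrow> b > a \<Longrightarrow> (b, b) \<in> model_index d \<Longrightarrow> f (b, b) = 0" for f i
  proof (rule model_eqI[OF model_mult_closed f])
    fix j assume j: "j \<in> model_index d"
    have "cross (T i (f i)) (\<lambda>j\<in>model_index d. if j = i then 0 else f j) j = 0"
      using 0[of "fst j" "snd j"] j model_index_diag[of "fst j" "snd j"] by (auto simp: cross_def T_def)
    then show "[(T i (f i) \<otimes>\<^bsub>H d\<^esub> (\<lambda>j\<in>model_index d. if j = i then 0 else f j)) j = f j] (mod int p)"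
      using model_mult_cong[OF j, of "T i (f i)" "\<lambda>j\<in>model_index d. if j = i then 0 else f j"] j
      by (cases "j = i") (simp_all add: T_def)
  qed
  have step: "f \<in> ?S" if f: "f \<in> carrier (H d)" and i: "i \<in> model_index d"
      and 0: "\<And>a b. i = (a, a) \<Longrightarrow> b > a \<Longrightarrow> (b, b) \<in> model_index d \<Longrightarrow> f (b, b) = 0"
      and S: "(\<lambda>j\<in>model_index d. if j = i then 0 else f j) \<in> ?S" for f i
  proof -
    have "f i \<in> {0..<int p}" using f i by (auto simp: model_group_def)
    then have "T i (f i) \<in> ?S" by (rule T[OF i])
    then have "T i (f i) \<otimes>\<^bsub>H d\<^esub> (\<lambda>j\<in>model_index d. if j = i then 0 else f j) \<in> ?S"
      by (rule S.m_closed[OF _ S])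
    moreover have "T i (f i) \<otimes>\<^bsub>H d\<^esub> (\<lambda>j\<in>model_index d. if j = i then 0 else f j) = f"
      by (rule split[OF f i]) (rule 0)
    ultimately show ?thesis by simp
  qed
  have zero_closed: "(\<lambda>j\<in>model_index d. if j = i then 0 else f j) \<in> carrier (H d)" if "f \<in> carrier (H d)" for f i
    using that p_pos by (auto simp: model_group_def PiE_iff)
  have off: "f \<in> ?S" if "finite A" "A \<subseteq> model_index d" "\<And>a. (a, a) \<notin> A" "f \<in> carrier (H d)"
      "\<And>i. i \<in> model_index d \<Longrightarrow> i \<notin> A \<Longrightarrow> f i = 0" for A f
    using that
  proof (induction A arbitrary: f)
    case empty
    then have "f = \<one>\<^bsub>H d\<^esub>" by (intro model_eqI) (auto simp: model_one)
    then show ?case using S.one_closed by (simp only:)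
  next
    case (insert i A)
    show ?case
    proof (rule step[OF insert.prems(3)])
      show "(\<lambda>j\<in>model_index d. if j = i then 0 else f j) \<in> ?S"
        using insert.prems by (intro insert.IH zero_closed) auto
    qed (use insert.prems in auto)
  qed
  \<comment> \<open>Diagonal entries beyond \<open>m\<close> are zero; for \<open>m = 0\<close> only
    off-diagonal entries are left.\<close>
  have diag: "f \<in> ?S" if "f \<in> carrier (H d)" "\<And>a. a > m \<Longrightarrow> (a, a) \<in> model_index d \<Longrightarrow> f (a, a) = 0" "m \<le> d" for f m
    using that
  proof (induction m arbitrary: f)
    case 0
    let ?A = "{i \<in> model_index d. fst i < snd i}"
    show ?case
    proof (rule off[of ?A])
      show "f i = 0" if "i \<in> model_index d" "i \<notin> ?A" for i
      proof -
        have "fst i = snd i" "0 < fst i" using that by (auto simp: model_index_def)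
        then show ?thesis using "0.prems"(2)[of "fst i"] that by (cases i) auto
      qed
    qed (use "0.prems" finite_model_index in auto)
  next
    case (Suc m)
    show ?case
    proof (rule step[OF Suc.prems(1), of "(Suc m, Suc m)"])
      show "(\<lambda>j\<in>model_index d. if j = (Suc m, Suc m) then 0 else f j) \<in> ?S"
      proof (intro Suc.IH zero_closed)
        show "(\<lambda>j\<in>model_index d. if j = (Suc m, Suc m) then 0 else f j) (a, a) = 0"
          if "m < a" "(a, a) \<in> model_index d" for a
          using Suc.prems(2)[of a] that by (cases "a = Suc m") auto
      qed (use Suc.prems in auto)
    qed (use Suc.prems in \<open>auto simp: model_index_def\<close>)
  qed
  have "carrier (H d) \<subseteq> ?S"
    using diag[of _ d] by (auto simp: model_index_def)
  then show ?thesis using S.subset by blast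
qed

end

section \<open>The presentation of the model group\<close>

context odd_prime begin

text \<open>Up to reduction modulo \<open>p\<close>, which the exponent of \<open>Q\<close> permits,
  \<open>push c\<close> and left multiplication by \<open>model_gen d c\<close> change the exponents
  in the same way. No information is lost by \<open>nat\<close>, since model entries are
  nonnegative.\<close>

lemma normal_form_model_gen:
  assumes "class_2_group Q" and exp: "\<And>x. x \<in> carrier Q \<Longrightarrow> x [^]\<^bsub>Q\<^esub> p = \<one>\<^bsub>Q\<^esub>"
    and y: "y \<in> {1..d} \<rightarrow> carrier Q" and c: "c \<in> {1..d}" and f: "f \<in> carrier (H d)"
  shows "y c \<otimes>\<^bsub>Q\<^esub> group.normal_form Q y (nat \<circ> f) d = group.normal_form Q y (nat \<circ> (model_gen d c \<otimes>\<^bsub>H d\<^esub> f)) d"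
proof -
  interpret class_2_group Q by fact
  have "y c \<otimes>\<^bsub>Q\<^esub> normal_form y (nat \<circ> f) d = normal_form y (\<lambda>i. push c (nat \<circ> f) i mod p) d"
    using normal_form_push[OF y, of d c "nat \<circ> f"] normal_form_mod[OF exp y, of d "push c (nat \<circ> f)"] c by simp
  also have "\<dots> = normal_form y (nat \<circ> (model_gen d c \<otimes>\<^bsub>H d\<^esub> f)) d"
  proof (rule normal_form_cong)
    fix i assume i: "i \<in> model_index d"
    have nonneg: "0 \<le> f j" if "j \<in> model_index d" for j
      using f that by (auto simp: model_group_def PiE_iff)
    have diag: "(snd i, snd i) \<in> model_index d" "(fst i, fst i) \<in> model_index d"
      using model_index_diag[of "fst i" "snd i"] i by auto
    have "int (push c (nat \<circ> f) i) = model_gen d c i + f i + cross (model_gen d c) f i"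
      using i diag nonneg[OF i] nonneg[OF diag(1)] by (cases i) (auto simp: push_def model_gen_def cross_def)
    then have "int (push c (nat \<circ> f) i mod p) = (model_gen d c \<otimes>\<^bsub>H d\<^esub> f) i"
      by (simp add: model_mult[OF i] zmod_int)
    then show "push c (nat \<circ> f) i mod p = (nat \<circ> (model_gen d c \<otimes>\<^bsub>H d\<^esub> f)) i"
      by (metis comp_apply nat_int)
  qed
  finally show ?thesis .
qed

text \<open>The value of a word in \<open>Q\<close> is thus determined by its value in the model, so
  a word trivial in the model is trivial in \<open>Q\<close>.\<close>

lemma free_eval_normal_form:
  assumes Q: "class_2_group Q" and exp: "\<And>x. x \<in> carrier Q \<Longrightarrow> x [^]\<^bsub>Q\<^esub> p = \<one>\<^bsub>Q\<^esub>"
    and y: "y \<in> {1..d} \<rightarrow> carrier Q" and u: "u \<in> lists ({1..d} \<times> UNIV)"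
  shows "free_eval Q y u = group.normal_form Q y (nat \<circ> model_eval d u) d"
  using u
proof (induction u)
  interpret class_2_group Q by fact
  case Nil
  have "normal_form y (nat \<circ> \<one>\<^bsub>H d\<^esub>) d = normal_form y (\<lambda>i. 0) d"
    by (rule normal_form_cong) (simp add: model_one)
  also have "\<dots> = \<one>\<^bsub>Q\<^esub>" by (rule normal_form_zero[OF y])
  finally show ?case unfolding free_eval_def model_eval_def by (simp only: foldr.simps id_apply)
next
  interpret class_2_group Q by fact
  interpret H: group "H d" by (rule model_is_group)
  case (Cons l u)
  obtain c s where l: "l = (c, s)" by (cases l)
  have c: "c \<in> {1..d}" using Cons.hyps l by auto
  have yc: "y c \<in> carrier Q" using y c by auto
  define f where "f = model_eval d u"
  have f: "f \<in> carrier (H d)" unfolding f_def model_eval_def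
    by (rule H.free_eval_closed[OF _ Cons.hyps(2)]) (simp add: model_gen_closed)
  have N: "normal_form y h d \<in> carrier Q" for h using normal_form_closed[OF y] by simp
  have IH: "free_eval Q y u = normal_form y (nat \<circ> f) d" using Cons.IH by (simp only: f_def)
  show ?case
  proof (cases s)
    case True
    have "free_eval Q y (l # u) = y c \<otimes>\<^bsub>Q\<^esub> free_eval Q y u"
      using l True by (simp add: free_eval_def letter_val_def)
    moreover have "model_eval d (l # u) = model_gen d c \<otimes>\<^bsub>H d\<^esub> f"
      using l True by (simp add: model_eval_def free_eval_def letter_val_def f_def)
    ultimately show ?thesis by (simp only: IH normal_form_model_gen[OF Q exp y c f])
  next
    case False
    \<comment> \<open>For an inverse letter the positive case is applied to the expected result
      \<open>?g\<close>, and \<open>y c\<close> is then cancelled.\<close>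
    let ?g = "inv\<^bsub>H d\<^esub> model_gen d c \<otimes>\<^bsub>H d\<^esub> f"
    have g: "?g \<in> carrier (H d)" using f model_gen_closed by simp
    have "model_gen d c \<otimes>\<^bsub>H d\<^esub> ?g = f"
      using f model_gen_closed by (simp add: H.m_assoc[symmetric])
    then have "y c \<otimes>\<^bsub>Q\<^esub> normal_form y (nat \<circ> ?g) d = normal_form y (nat \<circ> f) d"
      using normal_form_model_gen[OF Q exp y c g] by simp
    then have "inv\<^bsub>Q\<^esub> y c \<otimes>\<^bsub>Q\<^esub> normal_form y (nat \<circ> f) d = normal_form y (nat \<circ> ?g) d"
      using yc N inv_solve_left by metis
    moreover have "model_eval d (l # u) = ?g" using l False by (simp add: model_eval_def free_eval_def letter_val_def f_def)
    moreover have "free_eval Q y (l # u) = inv\<^bsub>Q\<^esub> y c \<otimes>\<^bsub>Q\<^esub> free_eval Q y u"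
      using l False by (simp add: free_eval_def letter_val_def)
    ultimately show ?thesis by (simp only: IH)
  qed
qed

text \<open>The model satisfies the relations, which gives one inclusion. Conversely, modulo any
  normal subgroup \<open>N\<close> containing the relators, a word in the kernel has a normal form
  with all exponents 0 and so lies in \<open>N\<close>.\<close>

lemma kernel_model_eval:
  fixes d :: nat
  defines "F \<equiv> free_group {1..d}"
  shows "kernel F (H d) (model_eval d)
    = normal_closure F ({a [^]\<^bsub>F\<^esub> p | a. a \<in> carrier F} \<union> triple_commutators F)"
    (is "?ker = normal_closure ?F ?S")
proof (rule equalityI)
  interpret e: group_hom ?F "H d" "model_eval d" unfolding F_def by (rule model_eval_hom)
  have "?S \<subseteq> ?ker"
  proof
    fix s assume "s \<in> ?S"
    then consider a where "s = a [^]\<^bsub>?F\<^esub> p" "a \<in> carrier ?F"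
      | a b c where "s = commutator ?F (commutator ?F a b) c" "a \<in> carrier ?F" "b \<in> carrier ?F" "c \<in> carrier ?F"
      by (auto simp: triple_commutators_def)
    then show "s \<in> ?ker"
    proof cases
      case 1
      then show ?thesis by (simp add: kernel_def e.hom_nat_pow model_exponent)
    next
      case 2
      note hc = hom_commutator[OF e.group_hom_axioms]
      have "model_eval d s = commutator (H d) (commutator (H d) (model_eval d a) (model_eval d b)) (model_eval d c)"
        using 2 hc by simp
      then have "model_eval d s \<in> triple_commutators (H d)"
        unfolding triple_commutators_def mem_Collect_eq
        by (intro exI[of _ "model_eval d a"] exI[of _ "model_eval d b"] exI[of _ "model_eval d c"])
          (use 2 in simp)
      then have "model_eval d s = \<one>\<^bsub>H d\<^esub>" using model_class_2 by blast
      moreover have "s \<in> carrier ?F" using 2 hc by simp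
      ultimately show ?thesis by (simp add: kernel_def)
    qed
  qed
  then show "normal_closure ?F ?S \<subseteq> ?ker"
    unfolding normal_closure_def using e.normal_kernel by blast
next
  show "?ker \<subseteq> normal_closure ?F ?S"
    unfolding normal_closure_def
  proof (rule subsetI, rule InterI, clarify)
    fix u N assume u: "u \<in> ?ker" and N: "N \<lhd> ?F" and S: "?S \<subseteq> N"
    interpret normal N ?F by fact
    interpret Q: group "?F Mod N" by (rule factorgroup_is_group)
    let ?q = "\<lambda>a. N #>\<^bsub>?F\<^esub> a"
    interpret q: group_hom ?F "?F Mod N" ?q
      using r_coset_hom_Mod by (simp add: group_hom_def group_hom_axioms_def Q.is_group is_group)
    have uF: "u \<in> carrier ?F" and eu: "model_eval d u = \<one>\<^bsub>H d\<^esub>" using u by (auto simp: kernel_def)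
    have in_N: "?q a = \<one>\<^bsub>?F Mod N\<^esub>" if "a \<in> N" for a
      using coset_join2[OF _ is_subgroup that] mem_carrier[OF that] by (simp add: FactGroup_def)
    have surj: "\<exists>a\<in>carrier ?F. x = ?q a" if "x \<in> carrier (?F Mod N)" for x
      using that by (auto simp: carrier_FactGroup)
    have exp: "x [^]\<^bsub>?F Mod N\<^esub> p = \<one>\<^bsub>?F Mod N\<^esub>" if x: "x \<in> carrier (?F Mod N)" for x
    proof -
      obtain a where a: "a \<in> carrier ?F" "x = ?q a" using surj[OF x] by blast
      then have "x [^]\<^bsub>?F Mod N\<^esub> p = ?q (a [^]\<^bsub>?F\<^esub> p)" by (simp add: q.hom_nat_pow)
      moreover have "a [^]\<^bsub>?F\<^esub> p \<in> N" using S a by blast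
      ultimately show ?thesis using in_N by simp
    qed
    have "triple_commutators (?F Mod N) \<subseteq> {\<one>\<^bsub>?F Mod N\<^esub>}"
    proof
      fix t assume "t \<in> triple_commutators (?F Mod N)"
      then obtain x y z where t: "t = commutator (?F Mod N) (commutator (?F Mod N) x y) z"
        and xyz: "x \<in> carrier (?F Mod N)" "y \<in> carrier (?F Mod N)" "z \<in> carrier (?F Mod N)"
        by (auto simp: triple_commutators_def)
      obtain a b c where abc: "a \<in> carrier ?F" "x = ?q a" "b \<in> carrier ?F" "y = ?q b" "c \<in> carrier ?F" "z = ?q c"
        using surj[OF xyz(1)] surj[OF xyz(2)] surj[OF xyz(3)] by blast
      have "commutator ?F (commutator ?F a b) c \<in> N"
        using S abc unfolding triple_commutators_def by blast
      moreover have "t = ?q (commutator ?F (commutator ?F a b) c)"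
        using t abc hom_commutator[OF q.group_hom_axioms] by simp
      ultimately show "t \<in> {\<one>\<^bsub>?F Mod N\<^esub>}" using in_N by simp
    qed
    then have Q: "class_2_group (?F Mod N)" by (simp add: class_2_group_def class_2_group_axioms_def Q.is_group)
    interpret Q: class_2_group "?F Mod N" by (rule Q)
    define y where "y = ?q \<circ> free_gen"
    have y: "y \<in> {1..d} \<rightarrow> carrier (?F Mod N)"
      using q.hom_closed free_gen_closed[of _ "{1..d}"] by (auto simp: y_def F_def)
    \<comment> \<open>The quotient map is evaluation at the cosets of the generators, because
      homomorphisms that agree on the generators are equal.\<close>
    have "?q u = free_eval (?F Mod N) y u"
    proof (rule hom_unique_free[OF Q.is_group])
      show "?q \<in> hom (free_group {1..d}) (?F Mod N)" using q.homh by (simp add: F_def)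
      show "free_eval (?F Mod N) y \<in> hom (free_group {1..d}) (?F Mod N)" by (rule Q.free_eval_hom[OF y])
      show "?q (free_gen x) = free_eval (?F Mod N) y (free_gen x)" if "x \<in> {1..d}" for x
        using Q.free_eval_gen[OF y that] by (simp add: y_def)
      show "u \<in> carrier (free_group {1..d})" using uF by (simp add: F_def)
    qed
    also have "\<dots> = Q.normal_form y (nat \<circ> model_eval d u) d"
      by (rule free_eval_normal_form[OF Q exp y]) (use uF in \<open>simp_all add: F_def free_group_def\<close>)
    also have "\<dots> = Q.normal_form y (nat \<circ> \<one>\<^bsub>H d\<^esub>) d" by (simp only: eu)
    also have "\<dots> = Q.normal_form y (\<lambda>i. 0) d"
      by (rule Q.normal_form_cong) (simp add: model_one)
    also have "\<dots> = N" using Q.normal_form_zero[OF y] by (simp add: FactGroup_def)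
    finally show "u \<in> N" using rcos_self[OF uF is_subgroup] by simp
  qed
qed

lemma free_class2_exp_group_iso: "free_class2_exp_group p d \<cong> H d"
proof -
  interpret e: group_hom "free_group {1..d}" "H d" "model_eval d" by (rule model_eval_hom)
  have "free_group {1..d} Mod kernel (free_group {1..d}) (H d) (model_eval d) \<cong> H d"
    by (rule e.FactGroup_iso[OF model_eval_surj])
  then show ?thesis using kernel_model_eval[of d]
    by (simp add: free_class2_exp_group_def Let_def)
qed

end

section \<open>Word maps\<close>

text \<open>The evaluation kernels of the finitely many argument tuples intersect in one member
  \<open>N\<close> of the inverse system. A representative of the coset \<open>w N\<close> then
  serves all tuples at once.\<close>

lemma word_value_free_eval:
  assumes p: "prime p" and G: "p_group_class_le_2 p G" and X: "finite X" and w: "w \<in> carrier (free_pro_p2 p X)"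
  shows "\<exists>b\<in>carrier (free_group X). \<forall>t\<in>X \<rightarrow>\<^sub>E carrier G. word_value p X G w t = free_eval G t b"
proof -
  let ?F = "free_group X" and ?T = "X \<rightarrow>\<^sub>E carrier G"
  interpret G: group G using G by (auto simp: p_group_class_le_2_def)
  interpret F: group ?F by (rule group_free_group)
  define \<kappa> where "\<kappa> t = kernel ?F G (free_eval G t)" for t
  have T: "t \<in> X \<rightarrow> carrier G" if "t \<in> ?T" for t using that by auto
  have \<kappa>: "\<kappa> t \<in> p2_kernels p X" if "t \<in> ?T" for t
    unfolding \<kappa>_def by (rule kernel_in_p2[OF p G G.free_eval_hom[OF T[OF that]]])
  obtain n where "order G = p ^ n" using G by (auto simp: p_group_class_le_2_def)
  then have "order G > 0" using p by (simp add: prime_gt_0_nat)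
  then have "finite (carrier G)" unfolding order_def using card_gt_0_iff by blast
  then have fin: "finite (\<kappa> ` ?T)" using X by (simp add: finite_PiE)
  have t1: "(\<lambda>x\<in>X. \<one>\<^bsub>G\<^esub>) \<in> ?T" by auto
  \<comment> \<open>The kernel of the trivial tuple belongs to the family already; it is singled out
    as the initial kernel for \<open>p2_Inter\<close>.\<close>
  define N where "N = \<kappa> (\<lambda>x\<in>X. \<one>\<^bsub>G\<^esub>) \<inter> \<Inter>(\<kappa> ` ?T)"
  have N: "N \<in> p2_kernels p X" unfolding N_def by (rule p2_Inter[OF p fin _ \<kappa>[OF t1]]) (use \<kappa> in auto)
  have "w N \<in> carrier (?F Mod N)" using w N by (auto simp: carrier_pro PiE_iff)
  then obtain b where b: "b \<in> carrier ?F" "w N = N #>\<^bsub>?F\<^esub> b" by (auto simp: carrier_FactGroup)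
  have "subgroup N ?F" using N by (auto simp: p2_kernels_def normal_def)
  then have bN: "b \<in> w N" using F.rcos_self[OF b(1)] b(2) by simp
  have "word_value p X G w t = free_eval G t b" if t: "t \<in> ?T" for t
  proof -
    obtain \<phi> where \<phi>: "cont_extension p X G t \<phi>" using cont_extension_ex[OF p G T[OF t]] by blast
    have "N \<subseteq> \<kappa> t" using t by (auto simp: N_def)
    then have "w N \<subseteq> w (\<kappa> t)" using w N \<kappa>[OF t] by (auto simp: carrier_pro)
    then have "\<phi> w = free_eval G t b"
      using cont_extension_value[OF p G T[OF t] \<phi> w] bN by (auto simp: \<kappa>_def)
    then show ?thesis using word_value_eq[OF p G T[OF t] w \<phi>] by simp
  qed
  then show ?thesis using b by blast
qed

section \<open>Expansion of word values in the model\<close>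

fun letter_sign :: "'x \<times> bool \<Rightarrow> int" where
  "letter_sign (x, s) = (if s then 1 else -1)"

primrec exponent_sum :: "('x \<times> bool) list \<Rightarrow> 'x \<Rightarrow> int" where
  "exponent_sum [] x = 0"
| "exponent_sum (l # u) x = (if fst l = x then letter_sign l else 0) + exponent_sum u x"

text \<open>\<open>cross_coeff u x y\<close> collects the cross terms of \<open>x\<close> and \<open>y\<close> in the value of \<open>u\<close> in \<open>model_group\<close>; the last
  summand is the cross term in \<open>model_inv\<close>.\<close>

primrec cross_coeff :: "('x \<times> bool) list \<Rightarrow> 'x \<Rightarrow> 'x \<Rightarrow> int" where
  "cross_coeff [] x y = 0"
| "cross_coeff (l # u) x y = cross_coeff u x y + (if fst l = x then letter_sign l * exponent_sum u y else 0)
     + (if fst l = x \<and> fst l = y \<and> \<not> snd l then 1 else 0)"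

text \<open>If all exponent sums vanish modulo \<open>p\<close>, so does the right-hand side; this
  makes the cross coefficients antisymmetric, and for odd \<open>p\<close> the case
  \<open>x = y\<close> gives the zero diagonal.\<close>

lemma cross_coeff_symmetric_part:
  "cross_coeff u x y + cross_coeff u y x = exponent_sum u x * exponent_sum u y - (if x = y then exponent_sum u x else 0)"
proof (induction u)
  case (Cons l u)
  then show ?case by (cases l) (auto simp: algebra_simps)
qed simp

context odd_prime begin

lemma cross_sum_right: "cross f (\<lambda>j. \<Sum>x\<in>X. c x * t x j) i = (\<Sum>x\<in>X. c x * cross f (t x) i)"
  by (simp add: cross_def sum_distrib_left mult_ac)

text \<open>A prepended letter contributes its linear term and its cross term with the rest of the
  word, whose diagonal is given by the exponent sums. An inverse letter also brings the correction
  from \<open>model_inv\<close>.\<close>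

lemma model_free_eval:
  assumes X: "finite X" and t: "t \<in> X \<rightarrow> carrier (H d)" and u: "u \<in> lists (X \<times> UNIV)" and i: "i \<in> model_index d"
  shows "[free_eval (H d) t u i = (\<Sum>x\<in>X. exponent_sum u x * t x i)
    + (\<Sum>x\<in>X. \<Sum>y\<in>X. cross_coeff u x y * cross (t x) (t y) i)] (mod int p)"
  using u i
proof (induction u arbitrary: i)
  case Nil
  then show ?case by (simp add: free_eval_def model_one)
next
  case (Cons l u)
  obtain m s where l: "l = (m, s)" by (cases l)
  have m: "m \<in> X" using Cons.hyps l by auto
  then have tm: "t m \<in> carrier (H d)" using t by auto
  \<comment> \<open>\<open>e\<close> is the sign of the letter; \<open>n\<close> marks an inverse
    letter, whose value carries the extra cross term.\<close>
  define e where "e = (if s then 1 else -1 :: int)"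
  define n where "n = (if s then 0 else 1 :: int)"
  define L where "L = letter_val (H d) t l"
  define E where "E = free_eval (H d) t u"
  have L: "[L j = e * t m j + n * cross (t m) (t m) j] (mod int p)" if "j \<in> model_index d" for j
    using that by (simp add: L_def l letter_val_def e_def n_def model_inv_eq[OF tm] model_inv_def cong_def)
  have "free_eval (H d) t (l # u) = L \<otimes>\<^bsub>H d\<^esub> E" by (simp add: free_eval_def L_def E_def)
  then have "[free_eval (H d) t (l # u) i = L i + E i + cross L E i] (mod int p)"
    using model_mult_cong[OF Cons.prems] by simp
  \<comment> \<open>Only diagonal entries matter to \<open>cross\<close>, and there \<open>L\<close>
    and \<open>E\<close> reduce to their linear parts.\<close>
  also have "[cross L E i = cross (\<lambda>j. e * t m j) (\<lambda>j. \<Sum>x\<in>X. exponent_sum u x * t x j) i] (mod int p)"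
  proof (rule cross_cong[OF Cons.prems])
    fix a assume a: "(a, a) \<in> model_index d"
    have diag0: "cross f g (a, a) = 0" for f g by (simp add: cross_def)
    show "[L (a, a) = e * t m (a, a)] (mod int p)" using L[OF a] by (simp add: diag0)
    show "[E (a, a) = (\<Sum>x\<in>X. exponent_sum u x * t x (a, a))] (mod int p)"
      using Cons.IH[OF a] by (simp add: diag0 E_def)
  qed
  then have "[L i + E i + cross L E i = (e * t m i + n * cross (t m) (t m) i)
    + ((\<Sum>x\<in>X. exponent_sum u x * t x i) + (\<Sum>x\<in>X. \<Sum>y\<in>X. cross_coeff u x y * cross (t x) (t y) i))
    + cross (\<lambda>j. e * t m j) (\<lambda>j. \<Sum>x\<in>X. exponent_sum u x * t x j) i] (mod int p)"
    unfolding E_def by (intro cong_add L Cons.IH Cons.prems) (simp_all add: E_def)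
  also have "(e * t m i + n * cross (t m) (t m) i)
    + ((\<Sum>x\<in>X. exponent_sum u x * t x i) + (\<Sum>x\<in>X. \<Sum>y\<in>X. cross_coeff u x y * cross (t x) (t y) i))
    + cross (\<lambda>j. e * t m j) (\<lambda>j. \<Sum>x\<in>X. exponent_sum u x * t x j) i
    = (\<Sum>x\<in>X. exponent_sum (l # u) x * t x i) + (\<Sum>x\<in>X. \<Sum>y\<in>X. cross_coeff (l # u) x y * cross (t x) (t y) i)"
  proof -
    have "(\<Sum>x\<in>X. exponent_sum (l # u) x * t x i)
      = (\<Sum>x\<in>X. (if m = x then e * t x i else 0) + exponent_sum u x * t x i)"
      by (rule sum.cong) (auto simp: l e_def algebra_simps)
    then have 1: "(\<Sum>x\<in>X. exponent_sum (l # u) x * t x i) = e * t m i + (\<Sum>x\<in>X. exponent_sum u x * t x i)"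
      using m X by (simp add: sum.distrib)
    have "(\<Sum>x\<in>X. \<Sum>y\<in>X. cross_coeff (l # u) x y * cross (t x) (t y) i)
      = (\<Sum>x\<in>X. \<Sum>y\<in>X. cross_coeff u x y * cross (t x) (t y) i
         + (if m = x then e * exponent_sum u y * cross (t x) (t y) i else 0)
         + (if m = x then (if m = y then n * cross (t x) (t y) i else 0) else 0))"
      by (intro sum.cong) (auto simp: l e_def n_def algebra_simps)
    also have "\<dots> = (\<Sum>x\<in>X. \<Sum>y\<in>X. cross_coeff u x y * cross (t x) (t y) i)
      + (\<Sum>x\<in>X. if m = x then (\<Sum>y\<in>X. e * exponent_sum u y * cross (t x) (t y) i) else 0)
      + (\<Sum>x\<in>X. if m = x then (\<Sum>y\<in>X. if m = y then n * cross (t x) (t y) i else 0) else 0)"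
      unfolding sum.distrib by (intro arg_cong2[of _ _ _ _ "(+)"] sum.cong) auto
    also have "\<dots> = (\<Sum>x\<in>X. \<Sum>y\<in>X. cross_coeff u x y * cross (t x) (t y) i)
      + (\<Sum>y\<in>X. e * exponent_sum u y * cross (t m) (t y) i) + n * cross (t m) (t m) i"
      using m X by simp
    also have "(\<Sum>y\<in>X. e * exponent_sum u y * cross (t m) (t y) i)
      = cross (\<lambda>j. e * t m j) (\<lambda>j. \<Sum>x\<in>X. exponent_sum u x * t x j) i"
      unfolding cross_sum_right by (rule sum.cong) (auto simp: cross_def)
    finally show ?thesis using 1 by simp
  qed
  finally show ?case .
qed

lemma cong_cancel:
  assumes "[c * a = c * b] (mod int p)" "\<not> [c = 0] (mod int p)"
  shows "[a = b] (mod int p)"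
proof -
  have "coprime c (int p)" using assms(2) prime_imp_coprime[of "int p" c] prime_p
    by (simp add: cong_0_iff coprime_commute)
  then show ?thesis using assms(1) cong_mult_lcancel by blast
qed

section \<open>Fibres of word maps on the model\<close>

lemma finite_model: "finite (carrier (H d))"
  by (simp add: model_group_def finite_PiE finite_model_index)

text \<open>With the other arguments fixed, the value is an injective, hence bijective, function of
  the argument at \<open>m\<close>. So every choice of the other arguments extends to a point of the
  fibre.\<close>

lemma card_fibre_nonzero:
  assumes X: "finite X" and u: "u \<in> lists (X \<times> UNIV)" and m: "m \<in> X"
    and nz: "\<not> [exponent_sum u m = 0] (mod int p)" and h: "h \<in> carrier (H d)"
  shows "order (H d) ^ (card X - 1) \<le> card {t \<in> X \<rightarrow>\<^sub>E carrier (H d). free_eval (H d) t u = h}" (is "_ \<le> card ?fibre")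
proof -
  interpret H: group "H d" by (rule model_is_group)
  let ?C = "carrier (H d)"
  have inj: "x = x'" if t: "t \<in> X \<rightarrow> ?C" and x: "x \<in> ?C" "x' \<in> ?C"
    and eq: "free_eval (H d) (t(m := x)) u = free_eval (H d) (t(m := x')) u" for t x x'
  proof -
    have tx: "t(m := x) \<in> X \<rightarrow> ?C" "t(m := x') \<in> X \<rightarrow> ?C" using t x by auto
    have *: "[x i = x' i] (mod int p)" if i: "i \<in> model_index d"
      and cr: "\<And>z z'. cross ((t(m := x)) z) ((t(m := x)) z') i = cross ((t(m := x')) z) ((t(m := x')) z') i" for i
    proof -
      let ?c = "\<Sum>z\<in>X. \<Sum>z'\<in>X. cross_coeff u z z' * cross ((t(m := x)) z) ((t(m := x)) z') i"
      let ?r = "\<Sum>z\<in>X - {m}. exponent_sum u z * t z i"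
      have lin: "(\<Sum>z\<in>X. exponent_sum u z * (t(m := y)) z i) = exponent_sum u m * y i + ?r" for y
        using sum.remove[OF X m, of "\<lambda>z. exponent_sum u z * (t(m := y)) z i"] by simp
      have "[free_eval (H d) (t(m := x)) u i = exponent_sum u m * x i + ?r + ?c] (mod int p)"
        using model_free_eval[OF X tx(1) u i] unfolding lin .
      moreover have "[free_eval (H d) (t(m := x)) u i = exponent_sum u m * x' i + ?r + ?c] (mod int p)"
        using model_free_eval[OF X tx(2) u i] unfolding lin eq[symmetric] cr[symmetric] .
      ultimately have "[exponent_sum u m * x i + ?r + ?c = exponent_sum u m * x' i + ?r + ?c] (mod int p)"
        using cong_trans cong_sym by blast
      then have "[exponent_sum u m * x i = exponent_sum u m * x' i] (mod int p)"
        by (simp add: cong_add_rcancel)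
      then show ?thesis by (rule cong_cancel[OF _ nz])
    qed
    have range: "x i \<in> {0..<int p}" "x' i \<in> {0..<int p}" if "i \<in> model_index d" for i
      using x that by (auto simp: model_group_def)
    \<comment> \<open>Diagonal entries are settled first, as cross terms vanish there. Once they
      agree, the cross terms agree at every other position too.\<close>
    have diag: "x (a, a) = x' (a, a)" if a: "(a, a) \<in> model_index d" for a
      using *[OF a] range[OF a] by (simp add: cross_def cong_def)
    show ?thesis
    proof (rule model_eqI[OF x])
      fix i assume i: "i \<in> model_index d"
      show "[x i = x' i] (mod int p)"
      proof (rule *[OF i])
        show "cross ((t(m := x)) z) ((t(m := x)) z') i = cross ((t(m := x')) z) ((t(m := x')) z') i" for z z'
          using model_index_diag[of "fst i" "snd i"] i diag by (simp add: cross_def)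
      qed
    qed
  qed
  have "(X - {m}) \<rightarrow>\<^sub>E ?C \<subseteq> (\<lambda>t. restrict t (X - {m})) ` ?fibre"
  proof
    fix r assume r: "r \<in> (X - {m}) \<rightarrow>\<^sub>E ?C"
    let ?t = "\<lambda>x. r(m := x)"
    have t: "?t x \<in> X \<rightarrow>\<^sub>E ?C" if "x \<in> ?C" for x using r that m by (auto simp: PiE_iff extensional_def)
    let ?f = "\<lambda>x. free_eval (H d) (?t x) u"
    have "?f ` ?C \<subseteq> ?C"
    proof clarify
      fix x assume "x \<in> ?C"
      then have "?t x \<in> X \<rightarrow> ?C" using t by blast
      then show "?f x \<in> ?C" using H.free_eval_closed[OF _ u] by blast
    qed
    moreover have "inj_on ?f ?C"
    proof (rule inj_onI)
      fix x x' assume *: "x \<in> ?C" "x' \<in> ?C" "?f x = ?f x'"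
      have "?t x \<in> X \<rightarrow> ?C" using t[OF *(1)] by auto
      then show "x = x'" using inj[of "?t x" x x'] * by simp
    qed
    ultimately have "?f ` ?C = ?C" using finite_model endo_inj_surj by blast
    then have "h \<in> ?f ` ?C" using h by simp
    then obtain x where x: "h = ?f x" "x \<in> ?C" by (rule imageE)
    have "restrict (?t x) (X - {m}) = r" using r by (auto simp: fun_eq_iff PiE_iff extensional_def)
    then show "r \<in> (\<lambda>t. restrict t (X - {m})) ` ?fibre" using t x by (intro image_eqI[of _ _ "?t x"]) auto
  qed
  moreover have "finite ?fibre"
    by (rule finite_subset[of _ "X \<rightarrow>\<^sub>E ?C"]) (use X finite_model in \<open>auto simp: finite_PiE\<close>)
  ultimately have "card ((X - {m}) \<rightarrow>\<^sub>E ?C) \<le> card ?fibre" by (rule surj_card_le[rotated])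
  then show ?thesis using X m by (simp add: card_PiE order_def)
qed

text \<open>The value depends only on the Gram matrix of the rows of diagonal entries. So any rows
  with the Gram matrix of \<open>t0\<close>, combined with arbitrary off-diagonal entries, give a
  point of the fibre.\<close>

lemma card_fibre_zero:
  assumes X: "finite X" "X \<noteq> {}" and u: "u \<in> lists (X \<times> UNIV)"
    and zero: "\<And>x. x \<in> X \<Longrightarrow> [exponent_sum u x = 0] (mod int p)" and t0: "t0 \<in> X \<rightarrow>\<^sub>E carrier (H d)"
  shows "order (H d) ^ (card X - 1) \<le> card {t \<in> X \<rightarrow>\<^sub>E carrier (H d). free_eval (H d) t u = free_eval (H d) t0 u}" (is "_ \<le> card ?fibre")
proof -
  interpret H: group "H d" by (rule model_is_group)
  interpret alternating_form p X "cross_coeff u"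
  proof (unfold_locales)
    fix x y assume xy: "x \<in> X" "y \<in> X"
    have "[exponent_sum u x * exponent_sum u y - (if x = y then exponent_sum u x else 0) = 0 * 0 - 0] (mod int p)"
      by (intro cong_diff cong_mult zero xy) (use zero xy in auto)
    then show "[cross_coeff u x y + cross_coeff u y x = 0] (mod int p)"
      by (simp add: cross_coeff_symmetric_part)
  next
    fix x assume x: "x \<in> X"
    have "[exponent_sum u x * exponent_sum u x - exponent_sum u x = 0 * 0 - 0] (mod int p)"
      by (intro cong_diff cong_mult zero x)
    \<comment> \<open>The symmetric part at \<open>x = y\<close> is twice the coefficient; 2 is
      cancelled below because \<open>p\<close> is odd.\<close>
    moreover have "2 * cross_coeff u x x = exponent_sum u x * exponent_sum u x - exponent_sum u x"
      using cross_coeff_symmetric_part[of u x x] by simp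
    ultimately have "[2 * cross_coeff u x x = 2 * 0] (mod int p)" by simp
    moreover have "\<not> [2 = 0] (mod int p)"
    proof
      assume "[2 = 0] (mod int p)"
      then have "p dvd 2" by (metis cong_0_iff int_dvd_int_iff of_nat_numeral)
      then have "p \<le> 2" by (rule dvd_imp_le) simp
      then show False using odd_p prime_ge_2_nat[OF prime_p] by (cases "p = 2") auto
    qed
    ultimately show "[cross_coeff u x x = 0] (mod int p)" by (rule cong_cancel)
  qed (use X prime_p in auto)
  let ?C = "carrier (H d)"
  \<comment> \<open>The transposed view: \<open>row t a\<close> collects the exponents of the
    \<open>a\<close>-th generator in all arguments into one vector over \<open>X\<close>.\<close>
  define row where "row t = (\<lambda>a\<in>{1..d}. \<lambda>x\<in>X. t x (a, a))" for t :: "'a \<Rightarrow> nat \<times> nat \<Rightarrow> int"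
  have eval: "[free_eval (H d) t u i = (if fst i < snd i then form (row t (fst i)) (row t (snd i)) else 0)] (mod int p)"
    if t: "t \<in> X \<rightarrow>\<^sub>E ?C" and i: "i \<in> model_index d" for t i
  proof -
    have "[(\<Sum>x\<in>X. exponent_sum u x * t x i) = (\<Sum>x\<in>X. 0 * t x i)] (mod int p)"
      by (intro cong_sum cong_mult zero) auto
    then have "[(\<Sum>x\<in>X. exponent_sum u x * t x i) + (\<Sum>x\<in>X. \<Sum>y\<in>X. cross_coeff u x y * cross (t x) (t y) i)
      = 0 + (\<Sum>x\<in>X. \<Sum>y\<in>X. cross_coeff u x y * cross (t x) (t y) i)] (mod int p)"
      by (intro cong_add) auto
    moreover have "(\<Sum>x\<in>X. \<Sum>y\<in>X. cross_coeff u x y * cross (t x) (t y) i)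
      = (if fst i < snd i then form (row t (fst i)) (row t (snd i)) else 0)"
    proof (cases "fst i < snd i")
      case True
      have "fst i \<in> {1..d}" "snd i \<in> {1..d}" using i by (auto simp: model_index_def)
      then show ?thesis using True unfolding form_def
        by (auto simp: row_def cross_def intro!: sum.cong)
    qed (simp add: cross_def)
    ultimately show ?thesis using cong_trans[OF model_free_eval[OF X(1) _ u i]] t by (auto simp: PiE_iff)
  qed
  define g where "g a b = form (row t0 a) (row t0 b)" for a b
  let ?R = "gram_tuples {1..d} g"
  have "row t0 \<in> ?R"
  proof -
    have "t0 x (a, a) \<in> {0..<int p}" if "x \<in> X" "a \<in> {1..d}" for x a
    proof -
      have "(a, a) \<in> model_index d" using that by (simp add: model_index_def)
      then show ?thesis using t0 that unfolding model_group_def by (auto simp: PiE_iff)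
    qed
    then show ?thesis by (auto simp: gram_tuples_def g_def row_def vectors_def)
  qed
  then have "?R \<noteq> {}" by blast
  then have gram: "p ^ (card X * d) \<le> p ^ (\<Sum>{..d}) * card ?R" using card_gram_tuples[of "{1..d}" g] by simp
  define off where "off = {i \<in> model_index d. fst i \<noteq> snd i}"
  have "model_index d = off \<union> (\<lambda>a. (a, a)) ` {1..d}" by (auto simp: off_def model_index_def)
  moreover have "off \<inter> (\<lambda>a. (a, a)) ` {1..d} = {}" by (auto simp: off_def)
  moreover have fin_off: "finite off" by (simp add: off_def finite_model_index)
  moreover have "card ((\<lambda>a. (a, a)) ` {1..d}) = d" by (subst card_image) (auto simp: inj_on_def)
  ultimately have card_off: "card off + d = (\<Sum>{..d})"
    using card_Un_disjoint[of off "(\<lambda>a. (a, a)) ` {1..d}"] card_model_index[of d] by simp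
  let ?O = "X \<rightarrow>\<^sub>E off \<rightarrow>\<^sub>E {0..<int p}"
  let ?f = "\<lambda>(r, s). \<lambda>x\<in>X. \<lambda>i\<in>model_index d. if fst i = snd i then r (fst i) x else s x i"
  have "card (?R \<times> ?O) \<le> card ?fibre"
  proof (rule card_inj_on_le[of ?f])
    show "finite ?fibre"
      by (rule finite_subset[of _ "X \<rightarrow>\<^sub>E ?C"]) (use X finite_model in \<open>auto simp: finite_PiE\<close>)
    show "inj_on ?f (?R \<times> ?O)"
    proof (rule inj_onI)
      fix z z' assume "z \<in> ?R \<times> ?O" "z' \<in> ?R \<times> ?O" and eq_z: "?f z = ?f z'"
      then obtain r s r' s' where z: "z = (r, s)" "z' = (r', s')"
        and r: "r \<in> ?R" "r' \<in> ?R" and s: "s \<in> ?O" "s' \<in> ?O" by (elim SigmaE) blast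
      have eq: "?f (r, s) = ?f (r', s')" using eq_z by (simp only: z)
      have eq': "(if fst i = snd i then r (fst i) x else s x i) = (if fst i = snd i then r' (fst i) x else s' x i)"
        if "x \<in> X" "i \<in> model_index d" for x i
        using fun_cong[OF fun_cong[OF eq, of x], of i] that by simp
      have "r = r'"
      proof (rule PiE_ext)
        show rr: "r \<in> {1..d} \<rightarrow>\<^sub>E vectors" "r' \<in> {1..d} \<rightarrow>\<^sub>E vectors" using r by (auto simp: gram_tuples_def)
        show "r a = r' a" if a: "a \<in> {1..d}" for a
        proof (rule PiE_ext)
          show "r a \<in> X \<rightarrow>\<^sub>E {0..<int p}" "r' a \<in> X \<rightarrow>\<^sub>E {0..<int p}" using rr a by (auto simp: vectors_def)
          show "r a x = r' a x" if "x \<in> X" for x using eq'[OF that, of "(a, a)"] a by (simp add: model_index_def)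
        qed
      qed
      moreover have "s = s'"
      proof (rule PiE_ext[OF s])
        show "s x = s' x" if x: "x \<in> X" for x
        proof (rule PiE_ext)
          show "s x \<in> off \<rightarrow>\<^sub>E {0..<int p}" "s' x \<in> off \<rightarrow>\<^sub>E {0..<int p}" using s x by auto
          show "s x i = s' x i" if "i \<in> off" for i using eq'[OF x, of i] that by (auto simp: off_def)
        qed
      qed
      ultimately show "z = z'" by (simp add: z)
    qed
    show "?f ` (?R \<times> ?O) \<subseteq> ?fibre"
    proof (rule image_subsetI)
      fix z assume "z \<in> ?R \<times> ?O"
      then obtain r s where z: "z = (r, s)" and r: "r \<in> ?R" and s: "s \<in> ?O" by (rule SigmaE)
      have rv: "r a x \<in> {0..<int p}" if "a \<in> {1..d}" "x \<in> X" for a x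
        using r that by (auto simp: gram_tuples_def vectors_def PiE_iff)
      have sv: "s x i \<in> {0..<int p}" if "i \<in> off" "x \<in> X" for i x
        using s that by (auto simp: PiE_iff)
      define t where "t = ?f (r, s)"
      have t: "t \<in> X \<rightarrow>\<^sub>E ?C"
      proof (rule PiE_I)
        fix x assume x: "x \<in> X"
        have "(\<lambda>i\<in>model_index d. if fst i = snd i then r (fst i) x else s x i) \<in> model_index d \<rightarrow>\<^sub>E {0..<int p}"
        proof (rule restrict_PiE_iff[THEN iffD2], rule ballI)
          fix i assume i: "i \<in> model_index d"
          then have "fst i \<in> {1..d}" by (auto simp: model_index_def)
          then show "(if fst i = snd i then r (fst i) x else s x i) \<in> {0..<int p}"
            using rv[of "fst i" x] sv[of i x] x i by (cases "fst i = snd i") (simp_all add: off_def)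
        qed
        then show "t x \<in> ?C" using x by (simp add: t_def model_group_def)
      qed (simp add: t_def)
      have row: "row t a x = r a x" if "a \<in> {1..d}" "x \<in> X" for a x
        using that by (simp add: row_def t_def model_index_def)
      have "form (row t a) (row t b) = form (r a) (r b)" if "a \<in> {1..d}" "b \<in> {1..d}" for a b
        unfolding form_def using row that by (auto intro!: sum.cong)
      then have gram: "[form (row t a) (row t b) = form (row t0 a) (row t0 b)] (mod int p)" if "a \<in> {1..d}" "b \<in> {1..d}" for a b
        using r that by (auto simp: gram_tuples_def g_def)
      have "free_eval (H d) t u = free_eval (H d) t0 u"
      proof (rule model_eqI)
        show "free_eval (H d) t u \<in> ?C" "free_eval (H d) t0 u \<in> ?C"
          using H.free_eval_closed[OF _ u] t t0 by (auto simp: PiE_iff)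
        fix i assume i: "i \<in> model_index d"
        have "fst i \<in> {1..d}" "snd i \<in> {1..d}" using i by (auto simp: model_index_def)
        then have "[(if fst i < snd i then form (row t (fst i)) (row t (snd i)) else 0)
          = (if fst i < snd i then form (row t0 (fst i)) (row t0 (snd i)) else 0)] (mod int p)"
          using gram by simp
        then show "[free_eval (H d) t u i = free_eval (H d) t0 u i] (mod int p)"
          by (rule cong_trans[OF cong_trans[OF eval[OF t i]] cong_sym[OF eval[OF t0 i]]])
      qed
      then have "t \<in> ?fibre" using t by blast
      then show "?f z \<in> ?fibre" by (simp only: t_def z)
    qed
  qed
  moreover have "card ?O = p ^ (card off * card X)" using X fin_off by (simp add: card_PiE power_mult)
  ultimately have le: "card ?R * p ^ (card off * card X) \<le> card ?fibre" by (simp add: card_cartesian_product)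
  \<comment> \<open>The inequality is shown after multiplication by the order of the group, which is
    exactly the factor \<open>p ^ \<Sum>{..d}\<close> lost in
    \<open>card_gram_tuples\<close>.\<close>
  have "order (H d) * order (H d) ^ (card X - 1) = order (H d) ^ card X"
    using X by (simp add: card_gt_0_iff power_eq_if)
  also have "\<dots> = p ^ (card X * d) * p ^ (card off * card X)"
    by (simp add: order_model card_off[symmetric] power_mult[symmetric] power_add[symmetric] algebra_simps)
  also have "\<dots> \<le> p ^ (\<Sum>{..d}) * card ?R * p ^ (card off * card X)"
    using gram by (rule mult_le_mono1)
  also have "\<dots> \<le> order (H d) * card ?fibre"
    using le by (simp add: order_model mult.assoc)
  finally show ?thesis using prime_p by (simp add: order_model prime_gt_0_nat)
qed

lemma card_fibre:
  assumes X: "finite X" and u: "u \<in> carrier (free_group X)" and t0: "t0 \<in> X \<rightarrow>\<^sub>E carrier (H d)" and "X \<noteq> {}"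
  shows "order (H d) ^ (card X - 1) \<le> card {t \<in> X \<rightarrow>\<^sub>E carrier (H d). free_eval (H d) t u = free_eval (H d) t0 u}"
proof -
  have u': "u \<in> lists (X \<times> UNIV)" using u by (simp add: free_group_def)
  have "free_eval (H d) t0 u \<in> carrier (H d)"
    using group.free_eval_closed[OF model_is_group _ u'] t0 by (auto simp: PiE_iff)
  then show ?thesis
    using card_fibre_nonzero[OF X u'] card_fibre_zero[OF X \<open>X \<noteq> {}\<close> u' _ t0] by blast
qed

end

text \<open>The conditions \<open>odd p\<close> and \<open>2 \<le> d\<close> express that the free
  group really has class 2 and exponent \<open>p\<close>. The bound for the model is carried to
  \<open>G\<close> along an isomorphism.\<close>

theorem mainTheorem6:
  fixes p d k :: nat and G :: "('a, 'b) monoid_scheme"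
    and w :: "(nat \<times> bool) list set \<Rightarrow> (nat \<times> bool) list set" and g :: 'a
  assumes "prime p" and "odd p" and "2 \<le> d"
    and "group G" and "G \<cong> free_class2_exp_group p d"
    and "1 \<le> k"
    and "w \<in> carrier (free_pro_p2 p {1..k})"
    and "g \<in> word_image p k G w"
  shows "word_fibre_size p k G w g \<ge> order G ^ (k - 1)"
proof -
  interpret odd_prime p using assms by unfold_locales
  interpret G: group G by fact
  interpret H: group "model_group p d" by (rule model_is_group)
  let ?H = "model_group p d" and ?X = "{1..k}"
  have "G \<cong> ?H" using iso_trans[OF assms(5) free_class2_exp_group_iso] .
  then have "?H \<cong> G" by (rule G.iso_sym)
  then obtain \<psi> where \<psi>: "\<psi> \<in> iso ?H G" by (auto simp: is_iso_def)
  then have bij: "bij_betw \<psi> (carrier ?H) (carrier G)" and hom: "\<psi> \<in> hom ?H G" by (auto simp: iso_def)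
  have "\<exists>\<phi>. \<phi> \<in> iso G ?H" using \<open>G \<cong> ?H\<close> by (auto simp: is_iso_def)
  then obtain \<phi> where \<phi>: "\<phi> \<in> hom G ?H" "bij_betw \<phi> (carrier G) (carrier ?H)" by (auto simp: iso_def)
  \<comment> \<open>The map \<open>\<phi>\<close> makes \<open>G\<close> a \<open>p\<close>-group of
    class at most 2, for which word values are well defined; \<open>\<psi>\<close> moves argument
    tuples from the model to \<open>G\<close>.\<close>
  have "group_hom G ?H \<phi>" using \<phi> by (simp add: group_hom_def group_hom_axioms_def G.is_group H.is_group)
  then have p2: "p_group_class_le_2 p G"
    by (rule inj_p_group_class_le_2[OF prime_p _ bij_betw_imp_inj_on[OF \<phi>(2)] model_p_group_class_le_2])
  obtain b where b: "b \<in> carrier (free_group ?X)"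
    and wb: "\<And>t. t \<in> ?X \<rightarrow>\<^sub>E carrier G \<Longrightarrow> word_value p ?X G w t = free_eval G t b"
    using word_value_free_eval[OF prime_p p2 _ assms(7)] by auto
  define transport where "transport s = (\<lambda>x\<in>?X. \<psi> (s x))" for s
  have transport: "transport s \<in> ?X \<rightarrow>\<^sub>E carrier G" if "s \<in> ?X \<rightarrow>\<^sub>E carrier ?H" for s
    using that hom_in_carrier[OF hom] by (auto simp: transport_def PiE_iff)
  have eval: "free_eval G (transport s) b = \<psi> (free_eval ?H s b)" if s: "s \<in> ?X \<rightarrow>\<^sub>E carrier ?H" for s
  proof -
    have sX: "s \<in> ?X \<rightarrow> carrier ?H" and pX: "transport s \<in> ?X \<rightarrow> carrier G" using s transport[OF s] by (auto simp: PiE_iff)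
    have "free_eval G (transport s) b = (\<psi> \<circ> free_eval ?H s) b"
    proof (rule hom_unique_free[OF G.is_group G.free_eval_hom[OF pX] hom_compose[OF H.free_eval_hom[OF sX] hom] _ b])
      show "free_eval G (transport s) (free_gen x) = (\<psi> \<circ> free_eval ?H s) (free_gen x)" if "x \<in> ?X" for x
        using G.free_eval_gen[OF pX that] H.free_eval_gen[OF sX that] that by (simp add: transport_def)
    qed
    then show ?thesis by simp
  qed
  obtain t0 where t0: "t0 \<in> ?X \<rightarrow>\<^sub>E carrier G" "g = free_eval G t0 b"
    using assms(8) wb unfolding word_image_def by auto
  \<comment> \<open>A preimage of the tuple realising \<open>g\<close>, so that \<open>g\<close>
    corresponds to a value attained in the model.\<close>
  define s0 where "s0 = (\<lambda>x\<in>?X. inv_into (carrier ?H) \<psi> (t0 x))"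
  have surj: "\<psi> ` carrier ?H = carrier G" using bij by (simp add: bij_betw_def)
  have s0: "s0 \<in> ?X \<rightarrow>\<^sub>E carrier ?H"
    using t0(1) inv_into_into[of _ \<psi> "carrier ?H"] by (auto simp: s0_def surj PiE_iff)
  have "transport s0 = t0"
  proof (rule PiE_ext[OF transport[OF s0] t0(1)])
    show "transport s0 x = t0 x" if "x \<in> ?X" for x
      using t0(1) that f_inv_into_f[of "t0 x" \<psi> "carrier ?H"] by (auto simp: transport_def s0_def surj PiE_iff)
  qed
  then have g: "g = \<psi> (free_eval ?H s0 b)" using eval[OF s0] t0(2) by simp
  let ?A = "{s \<in> ?X \<rightarrow>\<^sub>E carrier ?H. free_eval ?H s b = free_eval ?H s0 b}"
  let ?B = "{t \<in> ?X \<rightarrow>\<^sub>E carrier G. word_value p ?X G w t = g}"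
  have finG: "finite (carrier G)" using bij_betw_finite[OF bij] finite_model by simp
  have "order G ^ (k - 1) = order ?H ^ (card ?X - 1)"
    using bij_betw_same_card[OF bij] by (simp add: order_def)
  also have "\<dots> \<le> card ?A" by (rule card_fibre[OF _ b s0]) (use assms(6) in auto)
  also have "\<dots> \<le> card ?B"
  proof (rule card_inj_on_le[of transport])
    show "inj_on transport ?A"
    proof (rule inj_onI)
      fix s s' assume *: "s \<in> ?A" "s' \<in> ?A" "transport s = transport s'"
      then have s: "s \<in> ?X \<rightarrow>\<^sub>E carrier ?H" "s' \<in> ?X \<rightarrow>\<^sub>E carrier ?H" by auto
      show "s = s'"
      proof (rule PiE_ext[OF s])
        fix x assume x: "x \<in> ?X"
        then have "\<psi> (s x) = \<psi> (s' x)" using fun_cong[OF *(3), of x] by (simp add: transport_def)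
        moreover have "s x \<in> carrier ?H" "s' x \<in> carrier ?H" using s x by auto
        ultimately show "s x = s' x" using bij by (meson bij_betw_imp_inj_on inj_onD)
      qed
    qed
    show "transport ` ?A \<subseteq> ?B" using transport eval wb g by auto
    show "finite ?B"
      by (rule finite_subset[of _ "?X \<rightarrow>\<^sub>E carrier G"]) (use finG in \<open>auto simp: finite_PiE\<close>)
  qed
  finally show ?thesis by (simp add: word_fibre_size_def)
qed

end
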